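(* Let $f_1,\dots,f_m:\mathcal{M}\to\mathbb{R}$ be locally Lipschitz, $x\in\mathcal{M}$, $\varepsilon\in(0,\frac12\iota(x))$, and let $\bar g=\operatorname{argmin}_{\xi\in-G_\varepsilon(x)}\|\xi\|$, with $\bar g\neq0_x$. Then $$f_i(R_x(t\bar g))\le f_i(x)-t\|\bar g\|^2\qquad\text{for all } 0\le t\le\frac{\varepsilon}{\|\bar g\|}\text{ and all } i\in\{1,\dots,m\}.$$
   Context: $\mathcal{M}$ is a complete $d$-dimensional ($d\ge 1$) smooth Riemannian manifold with metric $\langle\cdot,\cdot\rangle$, induced norm $\|\cdot\|$ on tangent spaces, and Riemannian distance $\mathrm{dist}$. $\operatorname{cl}$, $\operatorname{conv}$ denote closure and convex hull; $0_x$ is the zero of $T_x\mathcal{M}$. Retraction: $R:T\mathcal{M}\to\mathcal{M}$ is a fixed smooth map such that, with $R_x=R|_{T_x\mathcal{M}}$, $R_x(0_x)=x$ and $\mathrm{D}R_x(0_x)=\mathrm{id}_{T_x\mathcal{M}}$; moreover there is $\kappa>0$ with $\mathrm{dist}(R_x(\xi),x)\le\kappa\|\xi\|$ for all $x$, $\xi\in T_x\mathcal{M}$. Write $B(0_x,r)=\{\xi\in T_x\mathcal{M}:\|\xi\|<r\}$, $B_R(x,r)=R_x(B(0_x,r))$, $\iota(x)=\sup\{r>0: R_x:B(0_x,r)\to B_R(x,r)\text{ is injective}\}$, $\iota(\mathcal{M})=\inf_x\iota(x)$; it is assumed that $\iota(\mathcal{M})>0$. Vector transport: $\mathcal{T}:T\mathcal{M}\oplus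 T\mathcal{M}\to T\mathcal{M}$, $(\eta_x,\xi_x)\mapsto\mathcal{T}_{\eta_x}(\xi_x)$, is a fixed smooth map such that $\mathcal{T}_{\eta_x}:T_x\mathcal{M}\to T_{R_x(\eta_x)}\mathcal{M}$ is linear and $\mathcal{T}_{0_x}=\mathrm{id}$. It is assumed isometric, $\langle\mathcal{T}_{\eta_x}\xi_x,\mathcal{T}_{\eta_x}\zeta_x\rangle=\langle\xi_x,\zeta_x\rangle$, and to satisfy the locking condition $\mathcal{T}_{\xi_x}(\xi_x)=\beta_{\xi_x}\,\mathrm{D}R_x(\xi_x)[\xi_x]$ with $\beta_{\xi_x}=\|\xi_x\|/\|\mathrm{D}R_x(\xi_x)[\xi_x]\|$ for $\xi_x\ne0_x$; convention $\beta_{0_x}=1$. For $y=R_x(\eta)$ with $\|\eta\|<\iota(x)$, $\mathcal{T}_{x\leftarrow y}:=(\mathcal{T}_\eta)^{-1}:T_y\mathcal{M}\to T_x\mathcal{M}$. Locally Lipschitz: every point has a neighborhood on which $|f(z)-f(y)|\le L\,\mathrm{dist}(z,y)$ for some $L>0$. Riemannian subdifferential: $\partial f(x)=\partial(f\circ R_x)(0_x)\subset T_x\mathcal{M}$, where the right side is the Clarke subdifferential on the Hilbert space $T_x\mathcal{M}$ ($\partial\phi(x)=\{\xi:\langle\xi,v\rangle\le\phi^\circ(x;v)\ \forall v\}$, $\phi^\circ(x;v)=\limsup_{y\to x,t\downarrow0}\frac{\phi(y+tv)-\phi(y)}{t}$). For $\varepsilon\in(0,\frac12\iota(x))$ the Riemannian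 $\varepsilon$-subdifferential is $\partial_\varepsilon f(x)=\operatorname{cl\,conv}\{\beta_\eta^{-1}\mathcal{T}_{x\leftarrow y}(\partial f(y)): y\in\operatorname{cl}B_R(x,\varepsilon),\ \eta=R_x^{-1}(y)\}$ (with $\eta$ the unique preimage of norm $<\iota(x)$), and $G_\varepsilon(x)=\operatorname{conv}\big(\bigcup_{i=1}^m\partial_\varepsilon f_i(x)\big)$, a nonempty compact convex set. *)

theory Defs
  imports "HOL-Analysis.Analysis"
begin

section \<open>Smooth maps between open subsets of normed spaces\<close>

primrec Ck_on :: "nat \<Rightarrow> 'u::real_normed_vector set \<Rightarrow> ('u \<Rightarrow> 'v::real_normed_vector) \<Rightarrow> bool" where
  "Ck_on 0 S f \<longleftrightarrow> continuous_on S f"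
| "Ck_on (Suc k) S f \<longleftrightarrow>
     (\<forall>x\<in>S. f differentiable (at x)) \<and> (\<forall>v. Ck_on k S (\<lambda>x. frechet_derivative f (at x) v))"

definition smooth_on :: "'u::real_normed_vector set \<Rightarrow> ('u \<Rightarrow> 'v::real_normed_vector) \<Rightarrow> bool" where
  "smooth_on S f \<longleftrightarrow> open S \<and> (\<forall>k. Ck_on k S f)"


section \<open>Riemannian manifolds\<close>

text \<open>
  The manifold is the whole topological type \<open>'a\<close>, of dimension \<open>DIM('e)\<close>. Its smooth structure is
  given by an atlas that is indexed by points: \<open>chart M q\<close>, with domain \<open>chart_dom M q\<close>, is a chart
  around \<open>q\<close> (any atlas can be presented in this way by choosing a chart around each point).

  The tangent space at \<open>p\<close> is the model space \<open>'e\<close>: a vector of \<open>'e\<close> stands for the tangent vector at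
  \<open>p\<close> whose components in the preferred chart \<open>chart M p\<close> are that vector. So \<open>riem M p\<close> is the inner
  product of the tangent space at \<open>p\<close> in these components, and the inner product and norm which \<open>'e\<close>
  has as a type enter only through the topology, which every inner product on \<open>'e\<close> induces.
  Components in another chart are obtained by \<open>coord_change\<close>.
\<close>

record ('a, 'e) manifold =
  chart :: "'a \<Rightarrow> 'a \<Rightarrow> 'e"
  chart_dom :: "'a \<Rightarrow> 'a set"
  riem :: "'a \<Rightarrow> 'e \<Rightarrow> 'e \<Rightarrow> real"

definition chart_inv :: "('a, 'e) manifold \<Rightarrow> 'a \<Rightarrow> 'e \<Rightarrow> 'a" where
  "chart_inv M q = inv_into (chart_dom M q) (chart M q)"

definition chart_img :: "('a, 'e) manifold \<Rightarrow> 'a \<Rightarrow> 'e set" where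
  "chart_img M q = chart M q ` chart_dom M q"

text \<open>Components in the chart at \<open>a\<close> to components in the chart at \<open>b\<close>, for tangent vectors at \<open>p\<close>.\<close>

definition coord_change ::
  "('a, 'e::euclidean_space) manifold \<Rightarrow> 'a \<Rightarrow> 'a \<Rightarrow> 'a \<Rightarrow> 'e \<Rightarrow> 'e" where
  "coord_change M a b p = frechet_derivative (chart M b \<circ> chart_inv M a) (at (chart M a p))"

definition smooth_manifold ::
  "('a::{t2_space, second_countable_topology}, 'e::euclidean_space) manifold \<Rightarrow> bool" where
  "smooth_manifold M \<longleftrightarrow>
     (\<forall>q. q \<in> chart_dom M q \<and> open (chart_dom M q) \<and> open (chart_img M q) \<and>
          homeomorphism (chart_dom M q) (chart_img M q) (chart M q) (chart_inv M q)) \<and>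
     (\<forall>a b. smooth_on (chart M a ` (chart_dom M a \<inter> chart_dom M b)) (chart M b \<circ> chart_inv M a))"

definition riemannian_manifold ::
  "('a::{t2_space, second_countable_topology}, 'e::euclidean_space) manifold \<Rightarrow> bool" where
  "riemannian_manifold M \<longleftrightarrow>
     smooth_manifold M \<and>
     (\<forall>p. bilinear (riem M p) \<and>
          (\<forall>v w. riem M p v w = riem M p w v) \<and>
          (\<forall>v. v \<noteq> 0 \<longrightarrow> riem M p v v > 0)) \<and>
     (\<forall>a v w. smooth_on (chart_img M a)
        (\<lambda>u. let p = chart_inv M a u
             in riem M p (coord_change M a p p v) (coord_change M a p p w)))"

definition tnorm :: "('a, 'e) manifold \<Rightarrow> 'a \<Rightarrow> 'e \<Rightarrow> real" where
  "tnorm M p v = sqrt (riem M p v v)"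

definition tball :: "('a, 'e) manifold \<Rightarrow> 'a \<Rightarrow> real \<Rightarrow> 'e set" where
  "tball M p r = {v. tnorm M p v < r}"

text \<open>Smoothness of a map from an open subset of a normed space into the manifold; openness of the
  preimages of the chart domains makes such a map continuous.\<close>

definition smooth_into ::
  "('a, 'e::euclidean_space) manifold \<Rightarrow> 'u::real_normed_vector set \<Rightarrow> ('u \<Rightarrow> 'a) \<Rightarrow> bool" where
  "smooth_into M S h \<longleftrightarrow>
     open S \<and> (\<forall>q. smooth_on {s\<in>S. h s \<in> chart_dom M q} (chart M q \<circ> h))"

definition smooth_arc ::
  "('a, 'e::euclidean_space) manifold \<Rightarrow> (real \<Rightarrow> 'a) \<Rightarrow> real \<Rightarrow> real \<Rightarrow> bool" where
  "smooth_arc M c a b \<longleftrightarrow>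
     (\<exists>J \<sigma>. {a..b} \<subseteq> J \<and> smooth_into M J \<sigma> \<and> (\<forall>t\<in>{a..b}. c t = \<sigma> t))"

definition piecewise_smooth_curve ::
  "('a, 'e::euclidean_space) manifold \<Rightarrow> (real \<Rightarrow> 'a) \<Rightarrow> bool" where
  "piecewise_smooth_curve M c \<longleftrightarrow>
     (\<exists>n s. s 0 = 0 \<and> s n = 1 \<and>
        (\<forall>i<n::nat. s i < s (Suc i) \<and> smooth_arc M c (s i) (s (Suc i))))"

text \<open>At the finitely many break points the velocity below may be a junk value; this does not affect
  the length.\<close>

definition velocity :: "('a, 'e::euclidean_space) manifold \<Rightarrow> (real \<Rightarrow> 'a) \<Rightarrow> real \<Rightarrow> 'e" where
  "velocity M c t = vector_derivative (chart M (c t) \<circ> c) (at t)"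

definition curve_length :: "('a, 'e::euclidean_space) manifold \<Rightarrow> (real \<Rightarrow> 'a) \<Rightarrow> ennreal" where
  "curve_length M c = (\<integral>\<^sup>+t\<in>{0..1}. ennreal (tnorm M (c t) (velocity M c t)) \<partial>lborel)"

text \<open>The distance is \<open>\<infinity>\<close> exactly between points of different connected components.\<close>

definition rdist :: "('a, 'e::euclidean_space) manifold \<Rightarrow> 'a \<Rightarrow> 'a \<Rightarrow> ennreal" where
  "rdist M p q =
     (INF c\<in>{c. piecewise_smooth_curve M c \<and> c 0 = p \<and> c 1 = q}. curve_length M c)"

definition complete_manifold :: "('a, 'e::euclidean_space) manifold \<Rightarrow> bool" where
  "complete_manifold M \<longleftrightarrow>
     (\<forall>s :: nat \<Rightarrow> 'a.
        (\<forall>e>0. \<exists>N. \<forall>m\<ge>N. \<forall>n\<ge>N. rdist M (s m) (s n) < ennreal e) \<longrightarrow>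
        (\<exists>l. (\<lambda>n. rdist M (s n) l) \<longlonglongrightarrow> 0))"


section \<open>Retractions and vector transports\<close>

text \<open>
  \<open>R x \<xi>\<close> is the value at \<open>\<xi>\<close> of the retraction restricted to the tangent space at \<open>x\<close>. Smoothness on the
  tangent bundle is tested in the bundle charts \<open>(u, v) \<mapsto> (p, coord_change M a p p v)\<close> with
  \<open>p = chart_inv M a u\<close>.
\<close>

definition smooth_retraction_map ::
  "('a, 'e::euclidean_space) manifold \<Rightarrow> ('a \<Rightarrow> 'e \<Rightarrow> 'a) \<Rightarrow> bool" where
  "smooth_retraction_map M R \<longleftrightarrow>
     (\<forall>a. smooth_into M (chart_img M a \<times> UNIV)
        (\<lambda>(u, v). let p = chart_inv M a u in R p (coord_change M a p p v)))"

text \<open>\<open>DR M R x \<xi>\<close> is the differential at \<open>\<xi>\<close> of the map \<open>R x\<close>, from the tangent space at \<open>x\<close> to the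
  tangent space at \<open>R x \<xi>\<close>.\<close>

definition DR ::
  "('a, 'e::euclidean_space) manifold \<Rightarrow> ('a \<Rightarrow> 'e \<Rightarrow> 'a) \<Rightarrow> 'a \<Rightarrow> 'e \<Rightarrow> 'e \<Rightarrow> 'e" where
  "DR M R x \<xi> = frechet_derivative (chart M (R x \<xi>) \<circ> R x) (at \<xi>)"

definition retraction_on ::
  "('a, 'e::euclidean_space) manifold \<Rightarrow> ('a \<Rightarrow> 'e \<Rightarrow> 'a) \<Rightarrow> bool" where
  "retraction_on M R \<longleftrightarrow>
     smooth_retraction_map M R \<and>
     (\<forall>x. R x 0 = x \<and> DR M R x 0 = id) \<and>
     (\<exists>\<kappa>>0. \<forall>x \<xi>. rdist M (R x \<xi>) x \<le> ennreal (\<kappa> * tnorm M x \<xi>))"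

definition rball ::
  "('a, 'e) manifold \<Rightarrow> ('a \<Rightarrow> 'e \<Rightarrow> 'a) \<Rightarrow> 'a \<Rightarrow> real \<Rightarrow> 'a set" where
  "rball M R x r = R x ` tball M x r"

definition inj_radius ::
  "('a, 'e) manifold \<Rightarrow> ('a \<Rightarrow> 'e \<Rightarrow> 'a) \<Rightarrow> 'a \<Rightarrow> ennreal" where
  "inj_radius M R x = (SUP r\<in>{r. 0 < r \<and> inj_on (R x) (tball M x r)}. ennreal r)"

definition global_inj_radius ::
  "('a, 'e) manifold \<Rightarrow> ('a \<Rightarrow> 'e \<Rightarrow> 'a) \<Rightarrow> ennreal" where
  "global_inj_radius M R = (INF x. inj_radius M R x)"

text \<open>\<open>T x \<eta> \<xi>\<close> transports \<open>\<xi>\<close> from the tangent space at \<open>x\<close> to the tangent space at \<open>R x \<eta>\<close>, along \<open>\<eta>\<close>.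
  Smoothness is tested in the bundle charts of the Whitney sum and of the tangent bundle.\<close>

definition smooth_transport_map ::
  "('a, 'e::euclidean_space) manifold \<Rightarrow> ('a \<Rightarrow> 'e \<Rightarrow> 'a) \<Rightarrow> ('a \<Rightarrow> 'e \<Rightarrow> 'e \<Rightarrow> 'e) \<Rightarrow> bool" where
  "smooth_transport_map M R T \<longleftrightarrow>
     (\<forall>a b. smooth_on
        {(u, v, w). u \<in> chart_img M a \<and>
           (let p = chart_inv M a u in R p (coord_change M a p p v) \<in> chart_dom M b)}
        (\<lambda>(u, v, w).
           let p = chart_inv M a u;
               \<eta> = coord_change M a p p v;
               \<xi> = coord_change M a p p w;
               q = R p \<eta>
           in (chart M b q, coord_change M q b q (T p \<eta> \<xi>))))"

definition vector_transport ::
  "('a, 'e::euclidean_space) manifold \<Rightarrow> ('a \<Rightarrow> 'e \<Rightarrow> 'a) \<Rightarrow> ('a \<Rightarrow> 'e \<Rightarrow> 'e \<Rightarrow> 'e) \<Rightarrow> bool" where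
  "vector_transport M R T \<longleftrightarrow>
     smooth_transport_map M R T \<and> (\<forall>x \<eta>. linear (T x \<eta>)) \<and> (\<forall>x. T x 0 = id)"

definition isometric_transport ::
  "('a, 'e) manifold \<Rightarrow> ('a \<Rightarrow> 'e \<Rightarrow> 'a) \<Rightarrow> ('a \<Rightarrow> 'e \<Rightarrow> 'e \<Rightarrow> 'e) \<Rightarrow> bool" where
  "isometric_transport M R T \<longleftrightarrow>
     (\<forall>x \<eta> \<xi> \<zeta>. riem M (R x \<eta>) (T x \<eta> \<xi>) (T x \<eta> \<zeta>) = riem M x \<xi> \<zeta>)"

definition beta :: "('a, 'e::euclidean_space) manifold \<Rightarrow> ('a \<Rightarrow> 'e \<Rightarrow> 'a) \<Rightarrow> 'a \<Rightarrow> 'e \<Rightarrow> real" where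
  "beta M R x \<xi> = (if \<xi> = 0 then 1 else tnorm M x \<xi> / tnorm M (R x \<xi>) (DR M R x \<xi> \<xi>))"

definition locking_condition ::
  "('a, 'e::euclidean_space) manifold \<Rightarrow> ('a \<Rightarrow> 'e \<Rightarrow> 'a) \<Rightarrow> ('a \<Rightarrow> 'e \<Rightarrow> 'e \<Rightarrow> 'e) \<Rightarrow> bool" where
  "locking_condition M R T \<longleftrightarrow> (\<forall>x \<xi>. T x \<xi> \<xi> = beta M R x \<xi> *\<^sub>R DR M R x \<xi> \<xi>)"


section \<open>Subdifferentials\<close>

definition locally_lipschitz ::
  "('a::topological_space, 'e::euclidean_space) manifold \<Rightarrow> ('a \<Rightarrow> real) \<Rightarrow> bool" where
  "locally_lipschitz M f \<longleftrightarrow>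
     (\<forall>p. \<exists>U L. open U \<and> p \<in> U \<and> L > 0 \<and>
        (\<forall>z\<in>U. \<forall>y\<in>U. ennreal \<bar>f z - f y\<bar> \<le> ennreal L * rdist M z y))"

definition clarke_dd :: "('e::real_normed_vector \<Rightarrow> real) \<Rightarrow> 'e \<Rightarrow> 'e \<Rightarrow> ereal" where
  "clarke_dd \<phi> x v =
     Limsup (nhds x \<times>\<^sub>F at_right 0) (\<lambda>(y, t). ereal ((\<phi> (y + t *\<^sub>R v) - \<phi> y) / t))"

text \<open>The first argument is the inner product that identifies the dual space with the space itself.\<close>

definition clarke_subdiff ::
  "('e \<Rightarrow> 'e \<Rightarrow> real) \<Rightarrow> ('e::real_normed_vector \<Rightarrow> real) \<Rightarrow> 'e \<Rightarrow> 'e set" where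
  "clarke_subdiff ip \<phi> x = {\<xi>. \<forall>v. ereal (ip \<xi> v) \<le> clarke_dd \<phi> x v}"

definition rsubdiff ::
  "('a, 'e::euclidean_space) manifold \<Rightarrow> ('a \<Rightarrow> 'e \<Rightarrow> 'a) \<Rightarrow> ('a \<Rightarrow> real) \<Rightarrow> 'a \<Rightarrow> 'e set" where
  "rsubdiff M R f x = clarke_subdiff (riem M x) (f \<circ> R x) 0"

definition eps_subdiff ::
  "('a::topological_space, 'e::euclidean_space) manifold \<Rightarrow> ('a \<Rightarrow> 'e \<Rightarrow> 'a) \<Rightarrow>
   ('a \<Rightarrow> 'e \<Rightarrow> 'e \<Rightarrow> 'e) \<Rightarrow> ('a \<Rightarrow> real) \<Rightarrow> real \<Rightarrow> 'a \<Rightarrow> 'e set" where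
  "eps_subdiff M R T f \<epsilon> x =
     closure (convex hull
       {inverse (beta M R x \<eta>) *\<^sub>R inv (T x \<eta>) \<xi> | y \<eta> \<xi>.
          y \<in> closure (rball M R x \<epsilon>) \<and>
          R x \<eta> = y \<and> ennreal (tnorm M x \<eta>) < inj_radius M R x \<and>
          \<xi> \<in> rsubdiff M R f y})"

definition G_eps ::
  "('a::topological_space, 'e::euclidean_space) manifold \<Rightarrow> ('a \<Rightarrow> 'e \<Rightarrow> 'a) \<Rightarrow>
   ('a \<Rightarrow> 'e \<Rightarrow> 'e \<Rightarrow> 'e) \<Rightarrow> (nat \<Rightarrow> 'a \<Rightarrow> real) \<Rightarrow> nat \<Rightarrow> real \<Rightarrow> 'a \<Rightarrow> 'e set" where
  "G_eps M R T f m \<epsilon> x = convex hull (\<Union>i\<in>{1..m}. eps_subdiff M R T (f i) \<epsilon> x)"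

end

theory Submission
  imports Defs
begin

text \<open>
  Let \<open>\<phi> s = f i (R x (s g))\<close> be the function along the retraction curve in the direction \<open>g = gbar\<close>. The
  claim is that \<open>\<phi>\<close> decreases at least with the slope \<open>- N\<^sup>2\<close>, where \<open>N\<close> is the norm of \<open>g\<close>, as long as
  \<open>s N \<le> \<epsilon>\<close>. Since \<open>\<phi>\<close> is continuous, it suffices to bound its upper right Dini derivative by \<open>- N\<^sup>2\<close> at
  each \<open>s\<close> with \<open>s N < \<epsilon>\<close> (\<open>decrease_of_right_Dini_bound\<close>).

  Fix such an \<open>s\<close>, let \<open>y = R x (s g)\<close> and let \<open>w\<close> be the velocity of the curve at \<open>y\<close>. To first order the
  curve agrees with \<open>h \<mapsto> R y (h w)\<close>, and a locally Lipschitz function does not see the difference. So the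
  Dini derivative is at most the Clarke derivative of \<open>f i \<circ> R y\<close> at zero in the direction \<open>w\<close>
  (\<open>right_Dini_le_clarke_dd\<close>). By the Hahn-Banach theorem this Clarke derivative equals the inner product of \<open>w\<close>
  with some subgradient \<open>\<xi>\<close> of \<open>f i\<close> at \<open>y\<close> (\<open>clarke_dd_attained\<close>). The transport is isometric and
  locked to the differential of the retraction, so this number is also the inner product, at \<open>x\<close>, of \<open>g\<close> with
  the rescaled and transported vector \<open>e\<close> that \<open>\<xi>\<close> contributes to the \<open>\<epsilon>\<close>-subdifferential
  (\<open>clarke_dd_along_ray_attained\<close>). Finally \<open>- g\<close> has the least norm in the convex set \<open>G_eps\<close>, which contains
  \<open>e\<close>, so the inner product of \<open>e\<close> with \<open>g\<close> is at most \<open>- N\<^sup>2\<close> (\<open>min_norm_variational_inequality\<close>).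

  The geometric input is the passage between the intrinsic Lipschitz condition, which is stated with the
  Riemannian distance, and Lipschitz bounds in a chart (\<open>rdist_le_chart_segment\<close>).
\<close>

section \<open>Smooth maps and Lipschitz bounds\<close>

lemma Ck_on_cong:
  fixes f g :: "'u::real_normed_vector \<Rightarrow> 'v::real_normed_vector"
  assumes "open S" "\<And>x. x \<in> S \<Longrightarrow> f x = g x" "Ck_on k S f"
  shows "Ck_on k S g"
  using assms(2,3)
proof (induction k arbitrary: f g)
  case 0
  then show ?case by (simp cong: continuous_on_cong)
next
  case (Suc k)
  have der: "(g has_derivative frechet_derivative f (at x)) (at x)" if "x \<in> S" for x
  proof -
    have "(f has_derivative frechet_derivative f (at x)) (at x)"
      using Suc.prems that by (simp add: frechet_derivative_works)
    then show ?thesis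
      by (rule has_derivative_transform_within_open[OF _ \<open>open S\<close> that]) (use Suc.prems in auto)
  qed
  then have "frechet_derivative f (at x) = frechet_derivative g (at x)" if "x \<in> S" for x
    using frechet_derivative_at that by blast
  then have "Ck_on k S (\<lambda>x. frechet_derivative g (at x) v)" for v
    using Suc.IH[of "\<lambda>x. frechet_derivative f (at x) v"] Suc.prems by simp
  with der show ?case
    by (auto simp: differentiable_def)
qed

lemma Ck_on_affine:
  fixes f :: "'u::real_normed_vector \<Rightarrow> 'v::real_normed_vector"
    and L :: "'w::real_normed_vector \<Rightarrow> 'u"
  assumes L: "bounded_linear L" and "open V" and V: "\<And>t. t \<in> V \<Longrightarrow> a + L t \<in> S"
    and "Ck_on k S f"
  shows "Ck_on k V (\<lambda>t. f (a + L t))"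
  using assms(4)
proof (induction k arbitrary: f)
  case 0
  have "continuous_on V (\<lambda>t. a + L t)"
    using L by (intro continuous_intros linear_continuous_on)
  moreover have "continuous_on S f" using 0 by simp
  moreover have "(\<lambda>t. a + L t) ` V \<subseteq> S" using V by blast
  ultimately show ?case
    using continuous_on_compose2[of S f V "\<lambda>t. a + L t"] by simp
next
  case (Suc k)
  have der: "((\<lambda>t. f (a + L t)) has_derivative (\<lambda>v. frechet_derivative f (at (a + L t)) (L v))) (at t)"
    if "t \<in> V" for t
  proof -
    have "((\<lambda>t. a + L t) has_derivative L) (at t)"
      using L by (auto intro!: derivative_eq_intros bounded_linear.has_derivative[OF L])
    moreover have "(f has_derivative frechet_derivative f (at (a + L t))) (at (a + L t))"
      using Suc.prems V that by (simp add: frechet_derivative_works)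
    ultimately show ?thesis
      by (rule has_derivative_compose)
  qed
  have "Ck_on k V (\<lambda>t. frechet_derivative f (at (a + L t)) (L v))" for v
    using Suc.IH[of "\<lambda>x. frechet_derivative f (at x) (L v)"] Suc.prems by simp
  moreover have "frechet_derivative (\<lambda>t. f (a + L t)) (at t)
      = (\<lambda>v. frechet_derivative f (at (a + L t)) (L v))" if "t \<in> V" for t
    using frechet_derivative_at[OF der[OF that]] by simp
  ultimately have "Ck_on k V (\<lambda>t. frechet_derivative (\<lambda>t. f (a + L t)) (at t) v)" for v
    using Ck_on_cong[OF \<open>open V\<close>, of "\<lambda>t. frechet_derivative f (at (a + L t)) (L v)"
        "\<lambda>t. frechet_derivative (\<lambda>t. f (a + L t)) (at t) v"] by simp
  with der show ?case
    by (auto simp: differentiable_def)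
qed

lemma smooth_on_affine:
  assumes "bounded_linear L" "open V" "\<And>t. t \<in> V \<Longrightarrow> a + L t \<in> S" "smooth_on S f"
  shows "smooth_on V (\<lambda>t. f (a + L t))"
  using assms Ck_on_affine unfolding smooth_on_def by blast

lemma smooth_on_cong:
  assumes "smooth_on S f" "\<And>x. x \<in> S \<Longrightarrow> f x = g x"
  shows "smooth_on S g"
  using assms Ck_on_cong unfolding smooth_on_def by blast

lemma smooth_on_imp_continuous_on: "smooth_on S f \<Longrightarrow> continuous_on S f"
  unfolding smooth_on_def by (metis Ck_on.simps(1))

lemma smooth_on_has_derivative:
  "smooth_on S f \<Longrightarrow> x \<in> S \<Longrightarrow> (f has_derivative frechet_derivative f (at x)) (at x)"
  unfolding smooth_on_def by (metis Ck_on.simps(2) frechet_derivative_works)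

lemma smooth_on_continuous_on_frechet_derivative:
  "smooth_on S f \<Longrightarrow> continuous_on S (\<lambda>x. frechet_derivative f (at x) v)"
  unfolding smooth_on_def by (metis Ck_on.simps(1,2))

text \<open>
  This turns continuous coefficients, of a derivative or of the metric, into uniform constants on a ball.
\<close>

lemma continuous_on_bounded_near:
  fixes F :: "'u::metric_space \<Rightarrow> real"
  assumes "open S" "z \<in> S" "continuous_on S F"
  obtains r where "r > 0" "ball z r \<subseteq> S" "\<And>u. u \<in> ball z r \<Longrightarrow> F u < F z + 1"
proof -
  have "isCont F z"
    using assms continuous_on_eq_continuous_at by blast
  then have "eventually (\<lambda>u. F u < F z + 1) (nhds z)"
    by (metis continuous_at eventually_nhds_conv_at less_add_one order_tendstoD(2) tendsto_at_iff_tendsto_nhds)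
  then have "eventually (\<lambda>u. u \<in> S \<and> F u < F z + 1) (nhds z)"
    using eventually_nhds_in_open[OF assms(1,2)] by (auto elim: eventually_elim2)
  then obtain r where "r > 0" "\<And>u. dist u z < r \<Longrightarrow> u \<in> S \<and> F u < F z + 1"
    unfolding eventually_nhds_metric by blast
  then show ?thesis
    by (intro that[of r]) (auto simp: dist_commute)
qed

lemma linear_norm_le_sum_Basis:
  fixes D :: "'u::euclidean_space \<Rightarrow> 'v::real_normed_vector"
  assumes "linear D"
  shows "norm (D v) \<le> (\<Sum>b\<in>Basis. norm (D b)) * norm v"
proof -
  have "D v = (\<Sum>b\<in>Basis. (v \<bullet> b) *\<^sub>R D b)"
    using linear_sum[OF assms] linear_scale[OF assms]
    by (metis (mono_tags, lifting) euclidean_representation sum.cong)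
  then have "norm (D v) \<le> (\<Sum>b\<in>Basis. \<bar>v \<bullet> b\<bar> * norm (D b))"
    using norm_sum[of "\<lambda>b. (v \<bullet> b) *\<^sub>R D b" Basis] by simp
  also have "\<dots> \<le> (\<Sum>b\<in>Basis. norm v * norm (D b))"
    by (intro sum_mono mult_right_mono Basis_le_norm) auto
  finally show ?thesis
    by (simp add: sum_distrib_left mult.commute)
qed

text \<open>
  The partial derivatives are continuous, hence bounded on a small ball. A ball is convex, so the mean
  value inequality turns this bound on the derivative into a Lipschitz constant.
\<close>

lemma smooth_on_locally_lipschitz:
  fixes f :: "'u::euclidean_space \<Rightarrow> 'v::real_normed_vector"
  assumes "smooth_on S f" "z \<in> S"
  obtains r K where "r > 0" "ball z r \<subseteq> S"
    "K-lipschitz_on (ball z r) f"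
proof -
  define F where "F u = (\<Sum>b\<in>Basis. norm (frechet_derivative f (at u) b))" for u
  have "continuous_on S F"
    unfolding F_def
    by (intro continuous_intros smooth_on_continuous_on_frechet_derivative assms)
  then obtain r where r: "r > 0" "ball z r \<subseteq> S" and F: "\<And>u. u \<in> ball z r \<Longrightarrow> F u < F z + 1"
    using continuous_on_bounded_near assms unfolding smooth_on_def by metis
  have der: "(f has_derivative frechet_derivative f (at u)) (at u)" if "u \<in> ball z r" for u
    using smooth_on_has_derivative assms(1) r(2) that by blast
  have "(F z + 1)-lipschitz_on (ball z r) f"
  proof (rule bounded_derivative_imp_lipschitz[OF _ convex_ball])
    show "0 \<le> F z + 1"
      unfolding F_def by (intro add_nonneg_nonneg sum_nonneg) auto
    fix u assume u: "u \<in> ball z r"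
    show "(f has_derivative frechet_derivative f (at u)) (at u within ball z r)"
      using der[OF u] by (rule has_derivative_at_withinI)
    have lin: "linear (frechet_derivative f (at u))"
      using der[OF u] by (rule has_derivative_linear)
    show "onorm (frechet_derivative f (at u)) \<le> F z + 1"
    proof (rule onorm_le)
      fix v
      have "norm (frechet_derivative f (at u) v) \<le> F u * norm v"
        unfolding F_def by (rule linear_norm_le_sum_Basis[OF lin])
      also have "\<dots> \<le> (F z + 1) * norm v"
        using F[OF u] by (intro mult_right_mono) auto
      finally show "norm (frechet_derivative f (at u) v) \<le> (F z + 1) * norm v" .
    qed
  qed
  with r show ?thesis by (rule that)
qed

section \<open>Functions with a bounded right Dini derivative\<close>

text \<open>
  For each slope \<open>c > a\<close> the set of times at which \<open>\<phi>\<close> lies below the line of slope \<open>c\<close> through the initial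
  value is closed, and the hypothesis extends it to the right of each of its points before \<open>b\<close>. So its
  supremum is \<open>b\<close>; then \<open>c\<close> decreases to \<open>a\<close>. The hypothesis says that the upper right Dini derivative is
  at most \<open>a\<close>.
\<close>

lemma decrease_of_right_Dini_bound:
  fixes \<phi> :: "real \<Rightarrow> real"
  assumes "continuous_on {0..b} \<phi>" "0 \<le> b"
    and dini: "\<And>s c. 0 \<le> s \<Longrightarrow> s < b \<Longrightarrow> a < c \<Longrightarrow>
      eventually (\<lambda>h. \<phi> (s + h) \<le> \<phi> s + c * h) (at_right 0)"
  shows "\<phi> b \<le> \<phi> 0 + a * b"
proof -
  have le: "\<phi> b \<le> \<phi> 0 + c * b" if "a < c" for c
  proof -
    define A where "A = {t \<in> {0..b}. \<phi> t \<le> \<phi> 0 + c * t}"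
    have "closed A"
      unfolding A_def using assms(1)
      by (intro continuous_on_closed_Collect_le continuous_intros) auto
    have "0 \<in> A" using \<open>0 \<le> b\<close> by (simp add: A_def)
    have bdd: "bdd_above A" by (auto simp: A_def)
    define u where "u = Sup A"
    have "u \<in> A"
      unfolding u_def using \<open>0 \<in> A\<close> by (intro closed_contains_Sup bdd \<open>closed A\<close>) auto
    have "\<not> u < b"
    proof
      assume "u < b"
      then have "eventually (\<lambda>h. \<phi> (u + h) \<le> \<phi> u + c * h) (at_right 0)"
        using \<open>u \<in> A\<close> that by (intro dini) (auto simp: A_def)
      moreover have "eventually (\<lambda>h. h \<in> {0<..<b - u}) (at_right 0)"
        using \<open>u < b\<close> by (intro eventually_at_right_real) simp
      ultimately have "eventually (\<lambda>h. h \<in> {0<..<b - u} \<and> \<phi> (u + h) \<le> \<phi> u + c * h) (at_right 0)"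
        by (auto elim: eventually_elim2)
      then obtain h where h: "h \<in> {0<..<b - u}" "\<phi> (u + h) \<le> \<phi> u + c * h"
        using eventually_happens'[OF trivial_limit_at_right_real] by blast
      then have "u + h \<in> A"
        using \<open>u \<in> A\<close> by (auto simp: A_def algebra_simps)
      then have "u + h \<le> u"
        unfolding u_def using bdd cSup_upper by blast
      with h show False by simp
    qed
    with \<open>u \<in> A\<close> have "u = b" by (auto simp: A_def)
    with \<open>u \<in> A\<close> show ?thesis by (simp add: A_def)
  qed
  show ?thesis
  proof (cases "b = 0")
    case False
    with \<open>0 \<le> b\<close> have "b > 0" by simp
    show ?thesis
    proof (rule field_le_epsilon)
      fix e :: real assume "0 < e"
      then have "a < a + e / b" using \<open>b > 0\<close> by simp
      from le[OF this] show "\<phi> b \<le> \<phi> 0 + a * b + e"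
        using \<open>b > 0\<close> by (simp add: algebra_simps)
    qed
  qed simp
qed

section \<open>Attainment of the Clarke directional derivative\<close>

text \<open>
  The analytic form of the Hahn-Banach theorem: a sublinear function is touched from below at any given
  vector by a linear function.
\<close>

lemma sublinear_support:
  fixes p :: "'e::euclidean_space \<Rightarrow> real"
  assumes add: "\<And>u v. p (u + v) \<le> p u + p v" and scale: "\<And>c v. 0 < c \<Longrightarrow> p (c *\<^sub>R v) = c * p v"
  obtains \<xi> where "\<And>v. \<xi> \<bullet> v \<le> p v" "\<xi> \<bullet> w = p w"
proof -
  \<comment> \<open>A hyperplane separates the epigraph of \<open>p\<close> from the open vertical ray below the point \<open>(w, p w)\<close>.\<close>
  define E where "E = {z. p (fst z) \<le> snd z}"
  define H where "H = {z. fst z = w \<and> snd z < p w}"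
  have scale0: "p (c *\<^sub>R v) \<le> c * p v" if "0 \<le> c" for c v
  proof (cases "c = 0")
    case True
    have "p 0 = 2 * p 0" using scale[of 2 0] by simp
    with True show ?thesis by simp
  qed (use scale that in auto)
  have "convex E"
  proof (rule convexI)
    fix y z and \<mu> \<nu> :: real
    assume h: "y \<in> E" "z \<in> E" "0 \<le> \<mu>" "0 \<le> \<nu>" "\<mu> + \<nu> = 1"
    have "p (\<mu> *\<^sub>R fst y + \<nu> *\<^sub>R fst z) \<le> \<mu> * p (fst y) + \<nu> * p (fst z)"
      using add[of "\<mu> *\<^sub>R fst y" "\<nu> *\<^sub>R fst z"] scale0[of \<mu> "fst y"] scale0[of \<nu> "fst z"] h by simp
    also have "\<dots> \<le> \<mu> * snd y + \<nu> * snd z"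
      using h by (intro add_mono mult_left_mono) (auto simp: E_def)
    finally show "\<mu> *\<^sub>R y + \<nu> *\<^sub>R z \<in> E" by (simp add: E_def)
  qed
  moreover have "convex H"
  proof -
    have "H = {w} \<times> {..<p w}" by (auto simp: H_def)
    then show ?thesis by (simp add: convex_Times)
  qed
  moreover have "(w, p w) \<in> E" "(w, p w - 1) \<in> H" by (auto simp: E_def H_def)
  moreover have "E \<inter> H = {}" by (auto simp: E_def H_def)
  ultimately obtain ab d where ab: "ab \<noteq> 0" and Hd: "\<forall>z\<in>H. ab \<bullet> z \<le> d" and Ed: "\<forall>z\<in>E. d \<le> ab \<bullet> z"
    using separating_hyperplane_sets[of H E] by (metis empty_iff inf_commute)
  obtain a b where [simp]: "ab = (a, b)" by (cases ab)
  have E: "d \<le> a \<bullet> v + b * r" if "p v \<le> r" for v r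
    using Ed that by (force simp: E_def)
  have H: "a \<bullet> w + b * r \<le> d" if "r < p w" for r
    using Hd that by (force simp: H_def)
  \<comment> \<open>The hyperplane is not vertical, since \<open>p\<close> is finite everywhere; hence it is the graph of an affine function.\<close>
  have "b > 0"
  proof -
    have "b \<ge> 0"
      using E[of w "p w"] H[of "p w - 1"] by (simp add: algebra_simps)
    moreover have "b \<noteq> 0"
    proof
      assume "b = 0"
      then have "a \<bullet> w \<le> a \<bullet> (w - a)"
        using E[of "w - a" "p (w - a)"] H[of "p w - 1"] by simp
      then have "a \<bullet> a = 0"
        using inner_ge_zero[of a] unfolding inner_diff_right by linarith
      then have "a = 0" by simp
      with \<open>b = 0\<close> ab show False by (simp add: zero_prod_def)
    qed
    ultimately show ?thesis by simp
  qed
  have key: "a \<bullet> w + b * p w \<le> a \<bullet> v + b * p v" for v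
  proof (rule field_le_epsilon)
    fix e :: real assume "0 < e"
    then have "a \<bullet> w + b * (p w - e / b) \<le> a \<bullet> v + b * p v"
      using E[of v "p v"] H[of "p w - e / b"] \<open>b > 0\<close> by simp
    then show "a \<bullet> w + b * p w \<le> a \<bullet> v + b * p v + e"
      using \<open>b > 0\<close> by (simp add: algebra_simps)
  qed
  define \<xi> where "\<xi> = (- 1 / b) *\<^sub>R a"
  have a: "a = - b *\<^sub>R \<xi>" using \<open>b > 0\<close> by (simp add: \<xi>_def)
  have key': "p w + \<xi> \<bullet> v \<le> p v + \<xi> \<bullet> w" for v
  proof -
    have "b * (p w + \<xi> \<bullet> v) \<le> b * (p v + \<xi> \<bullet> w)"
      using key[of v] by (simp add: a algebra_simps)
    then show ?thesis using \<open>b > 0\<close> by simp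
  qed
  have "p 0 \<le> 0" using scale0[of 0 0] by simp
  then have "p w \<le> \<xi> \<bullet> w" using key'[of 0] by simp
  moreover have "\<xi> \<bullet> w \<le> p w" using key'[of "2 *\<^sub>R w"] scale[of 2 w] by simp
  ultimately have eq: "\<xi> \<bullet> w = p w" by simp
  then have "\<xi> \<bullet> v \<le> p v" for v using key'[of v] by simp
  with eq that show ?thesis by blast
qed

definition inner_form :: "('e::euclidean_space \<Rightarrow> 'e \<Rightarrow> real) \<Rightarrow> bool" where
  "inner_form ip \<longleftrightarrow> bilinear ip \<and> (\<forall>v w. ip v w = ip w v) \<and> (\<forall>v. v \<noteq> 0 \<longrightarrow> ip v v > 0)"

text \<open>
  The two inner products on the finite-dimensional space differ by an injective, hence bijective, linear
  map. So a linear functional can be represented by either one.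
\<close>

lemma inner_form_riesz:
  assumes "inner_form ip"
  obtains \<xi>' where "\<And>v. ip \<xi>' v = \<xi> \<bullet> v"
proof -
  have bil: "bilinear ip" using assms by (simp add: inner_form_def)
  define L where "L u = (\<Sum>b\<in>Basis. ip u b *\<^sub>R b)" for u
  have L: "L u \<bullet> v = ip u v" for u v
  proof -
    have lin: "linear (ip u)" using bil by (simp add: bilinear_def)
    have "ip u v = ip u (\<Sum>b\<in>Basis. (v \<bullet> b) *\<^sub>R b)" by (simp add: euclidean_representation)
    also have "\<dots> = (\<Sum>b\<in>Basis. (v \<bullet> b) * ip u b)"
      by (simp add: linear_sum[OF lin] linear_scale[OF lin])
    finally show ?thesis
      by (simp add: L_def inner_sum_left inner_commute[of v] mult.commute)
  qed
  have "linear L"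
    by (rule linearI; rule euclidean_eqI)
       (simp_all add: L inner_add_left bilinear_ladd[OF bil] bilinear_lmul[OF bil])
  moreover have "inj L"
    unfolding linear_injective_0[OF \<open>linear L\<close>]
    using L assms by (metis inner_form_def inner_zero_left less_irrefl)
  ultimately have "surj L" by (rule linear_inj_imp_surj)
  then show ?thesis using L that by (metis surjD)
qed

text \<open>
  The upper limit in the Clarke derivative lets the base point vary. Hence the base point may be moved along
  a second direction by the same step; subadditivity in the direction rests on this.
\<close>

lemma filterlim_shift_prod_nhds_at_right:
  fixes x v :: "'e::real_normed_vector"
  shows "filterlim (\<lambda>(y, t). (y + t *\<^sub>R v, t)) (nhds x \<times>\<^sub>F at_right 0) (nhds x \<times>\<^sub>F at_right (0::real))"
proof -
  have fst: "filterlim fst (nhds x) (nhds x \<times>\<^sub>F at_right (0::real))"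
    by (rule filterlim_fst)
  have snd: "filterlim snd (at_right 0) (nhds x \<times>\<^sub>F at_right (0::real))"
    by (rule filterlim_snd)
  then have "filterlim snd (nhds 0) (nhds x \<times>\<^sub>F at_right (0::real))"
    by (simp add: filterlim_at)
  then have "filterlim (\<lambda>z. fst z + snd z *\<^sub>R v) (nhds (x + 0 *\<^sub>R v)) (nhds x \<times>\<^sub>F at_right (0::real))"
    by (intro tendsto_intros fst)
  then show ?thesis
    using filterlim_Pair[OF _ snd] by (simp add: case_prod_unfold)
qed

context
  fixes \<phi> :: "'e::euclidean_space \<Rightarrow> real" and x :: 'e and r K :: real
  assumes r: "r > 0"
    and lip: "K-lipschitz_on (ball x r) \<phi>"
begin

lemma clarke_dd_bounds: "ereal (- (K * norm v)) \<le> clarke_dd \<phi> x v" "clarke_dd \<phi> x v \<le> ereal (K * norm v)"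
proof -
  let ?F = "nhds x \<times>\<^sub>F at_right (0::real)"
  have 1: "eventually (\<lambda>z. fst z \<in> ball x r) ?F"
    using r by (intro eventually_compose_filterlim[OF _ filterlim_fst] eventually_nhds_in_open) auto
  have 2: "eventually (\<lambda>z. fst z + snd z *\<^sub>R v \<in> ball x r) ?F"
    using eventually_compose_filterlim[OF 1 filterlim_shift_prod_nhds_at_right[of v x]]
    by (simp add: case_prod_unfold)
  have 3: "eventually (\<lambda>z. snd z > 0) ?F"
    by (intro eventually_compose_filterlim[OF _ filterlim_snd] eventually_at_right_less)
  have q: "eventually (\<lambda>z. (\<phi> (fst z + snd z *\<^sub>R v) - \<phi> (fst z)) / snd z \<in> {- (K * norm v)..K * norm v}) ?F"
    using 1 2 3
  proof eventually_elim
    case (elim z)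
    then have "\<bar>\<phi> (fst z + snd z *\<^sub>R v) - \<phi> (fst z)\<bar> \<le> K * norm (snd z *\<^sub>R v)"
      using lipschitz_on_normD[OF lip, of "fst z + snd z *\<^sub>R v" "fst z"] by simp
    with elim(3) show ?case by (simp add: field_simps abs_le_iff)
  qed
  have nt: "?F \<noteq> bot" by (simp add: prod_filter_eq_bot)
  show "clarke_dd \<phi> x v \<le> ereal (K * norm v)"
    unfolding clarke_dd_def
    by (rule Limsup_bounded) (use q in \<open>auto elim!: eventually_mono\<close>)
  show "ereal (- (K * norm v)) \<le> clarke_dd \<phi> x v"
    unfolding clarke_dd_def
    by (rule order_trans[OF _ Liminf_le_Limsup[OF nt]], rule Liminf_bounded)
       (use q in \<open>auto elim!: eventually_mono\<close>)
qed

lemma clarke_dd_finite: "clarke_dd \<phi> x v = ereal (real_of_ereal (clarke_dd \<phi> x v))"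
  using clarke_dd_bounds[of v] by (cases "clarke_dd \<phi> x v") auto

lemma clarke_dd_add: "clarke_dd \<phi> x (u + v) \<le> clarke_dd \<phi> x u + clarke_dd \<phi> x v"
proof -
  let ?F = "nhds x \<times>\<^sub>F at_right (0::real)"
  define Q where "Q v z = (\<phi> (fst z + snd z *\<^sub>R v) - \<phi> (fst z)) / snd z" for v z
  have dd: "clarke_dd \<phi> x v = Limsup ?F (\<lambda>z. ereal (Q v z))" for v
    by (simp add: clarke_dd_def Q_def case_prod_unfold)
  obtain a b where ab: "clarke_dd \<phi> x u = ereal a" "clarke_dd \<phi> x v = ereal b"
    using clarke_dd_finite by metis
  have "clarke_dd \<phi> x (u + v) \<le> ereal (a + b)"
  proof (rule ereal_le_epsilon2)
    fix e :: real assume "0 < e"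
    have "eventually (\<lambda>z. Q u z < a + e / 2) ?F"
      using Limsup_lessD[of ?F "\<lambda>z. ereal (Q u z)" "ereal (a + e / 2)"] ab dd \<open>0 < e\<close> by simp
    moreover have "eventually (\<lambda>z. Q v z < b + e / 2) ?F"
      using Limsup_lessD[of ?F "\<lambda>z. ereal (Q v z)" "ereal (b + e / 2)"] ab dd \<open>0 < e\<close> by simp
    \<comment> \<open>The quotient in direction \<open>v\<close> is taken at the base point that was moved by \<open>t u\<close>.\<close>
    then have "eventually (\<lambda>z. Q v (fst z + snd z *\<^sub>R u, snd z) < b + e / 2) ?F"
      using filterlim_shift_prod_nhds_at_right[of u x]
      by (auto simp: filterlim_iff case_prod_unfold)
    ultimately have "eventually (\<lambda>z. Q (u + v) z \<le> a + b + e) ?F"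
    proof eventually_elim
      case (elim z)
      have "Q (u + v) z = Q u z + Q v (fst z + snd z *\<^sub>R u, snd z)"
        by (simp add: Q_def scaleR_add_right add.assoc flip: add_divide_distrib)
      with elim show ?case by simp
    qed
    then show "clarke_dd \<phi> x (u + v) \<le> ereal (a + b) + ereal e"
      unfolding dd by (intro Limsup_bounded) (auto elim!: eventually_mono)
  qed
  with ab show ?thesis by simp
qed

text \<open>
  Replacing the step \<open>t\<close> by \<open>c t\<close> rescales the difference quotient. The reverse inequality follows by applying
  this one to the inverse factor.
\<close>

lemma clarke_dd_scale_le:
  assumes "0 < c"
  shows "clarke_dd \<phi> x (c *\<^sub>R v) \<le> ereal c * clarke_dd \<phi> x v"
proof -
  let ?F = "nhds x \<times>\<^sub>F at_right (0::real)"
  define Q where "Q v z = (\<phi> (fst z + snd z *\<^sub>R v) - \<phi> (fst z)) / snd z" for v z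
  have dd: "clarke_dd \<phi> x v = Limsup ?F (\<lambda>z. ereal (Q v z))" for v
    by (simp add: clarke_dd_def Q_def case_prod_unfold)
  obtain a where a: "clarke_dd \<phi> x v = ereal a"
    using clarke_dd_finite by metis
  have "((\<lambda>t. c * t) \<longlongrightarrow> c * 0) (at_right 0)"
    by (intro tendsto_intros)
  then have "filterlim (\<lambda>t. c * t) (at_right 0) (at_right (0::real))"
    using assms by (auto simp: filterlim_at eventually_at_filter)
  then have fl: "filterlim (\<lambda>z. (fst z, c * snd z)) ?F ?F"
    by (intro filterlim_Pair filterlim_fst filterlim_compose[OF _ filterlim_snd])
  have "clarke_dd \<phi> x (c *\<^sub>R v) \<le> ereal (c * a)"
  proof (rule ereal_le_epsilon2)
    fix e :: real assume "0 < e"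
    then have "eventually (\<lambda>z. Q v z < a + e / c) ?F"
      using Limsup_lessD[of ?F "\<lambda>z. ereal (Q v z)" "ereal (a + e / c)"] a dd assms by simp
    then have "eventually (\<lambda>z. Q v (fst z, c * snd z) < a + e / c) ?F"
      using fl by (auto simp: filterlim_iff)
    then have "eventually (\<lambda>z. Q (c *\<^sub>R v) z \<le> c * a + e) ?F"
    proof eventually_elim
      case (elim z)
      have "Q (c *\<^sub>R v) z = c * Q v (fst z, c * snd z)"
        using assms by (simp add: Q_def mult.commute)
      also have "\<dots> \<le> c * (a + e / c)" using elim assms by simp
      finally show ?case using assms by (simp add: algebra_simps)
    qed
    then show "clarke_dd \<phi> x (c *\<^sub>R v) \<le> ereal (c * a) + ereal e"
      unfolding dd by (intro Limsup_bounded) (auto elim!: eventually_mono)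
  qed
  with a show ?thesis by simp
qed

text \<open>
  For a function that is Lipschitz near the point, the Clarke directional derivative is finite and
  sublinear in the direction, so it has a supporting linear function. By Riesz representation this is a
  Clarke subgradient at which the supremum over the subdifferential is attained in the given direction.
\<close>

lemma clarke_dd_attained:
  assumes "inner_form ip"
  obtains \<xi> where "\<xi> \<in> clarke_subdiff ip \<phi> x" "clarke_dd \<phi> x w = ereal (ip \<xi> w)"
proof -
  define p where "p v = real_of_ereal (clarke_dd \<phi> x v)" for v
  have p: "clarke_dd \<phi> x v = ereal (p v)" for v
    using clarke_dd_finite p_def by simp
  have scale_le: "p (c *\<^sub>R v) \<le> c * p v" if "0 < c" for c v
    using clarke_dd_scale_le[OF that, of v] by (simp add: p)
  have "p (c *\<^sub>R v) = c * p v" if "0 < c" for c v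
  proof (rule antisym[OF scale_le[OF that]])
    show "c * p v \<le> p (c *\<^sub>R v)"
      using scale_le[of "inverse c" "c *\<^sub>R v"] that by (simp add: field_simps)
  qed
  moreover have "p (u + v) \<le> p u + p v" for u v
    using clarke_dd_add[of u v] by (simp add: p)
  ultimately obtain \<xi>\<^sub>0 where \<xi>\<^sub>0: "\<And>v. \<xi>\<^sub>0 \<bullet> v \<le> p v" "\<xi>\<^sub>0 \<bullet> w = p w"
    using sublinear_support[of p] by metis
  obtain \<xi> where "\<And>v. ip \<xi> v = \<xi>\<^sub>0 \<bullet> v"
    using inner_form_riesz[OF assms] by metis
  with \<xi>\<^sub>0 that[of \<xi>] show ?thesis by (simp add: clarke_subdiff_def p)
qed

end

text \<open>
  Fixing the base point in the upper limit only makes the limit smaller.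
\<close>

lemma clarke_dd_right_quotient:
  assumes "clarke_dd \<phi> x v < ereal c"
  shows "eventually (\<lambda>h. \<phi> (x + h *\<^sub>R v) \<le> \<phi> x + c * h) (at_right 0)"
proof -
  have "eventually (\<lambda>(y, t). (\<phi> (y + t *\<^sub>R v) - \<phi> y) / t < c) (nhds x \<times>\<^sub>F at_right 0)"
    using Limsup_lessD[OF assms[unfolded clarke_dd_def]] by (simp add: case_prod_unfold)
  then have "eventually (\<lambda>h. (\<phi> (x + h *\<^sub>R v) - \<phi> x) / h < c) (at_right 0)"
    unfolding eventually_prod_filter
    by (auto dest: eventually_nhds_x_imp_x elim!: eventually_mono)
  moreover have "eventually (\<lambda>h::real. h > 0) (at_right 0)"
    by (rule eventually_at_right_less)
  ultimately show ?thesis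
    by eventually_elim (simp add: field_simps)
qed

section \<open>The Riemannian distance in a chart\<close>

lemma smooth_manifoldD:
  assumes "smooth_manifold M"
  shows "q \<in> chart_dom M q" "open (chart_dom M q)" "open (chart_img M q)"
    "homeomorphism (chart_dom M q) (chart_img M q) (chart M q) (chart_inv M q)"
    "smooth_on (chart M a ` (chart_dom M a \<inter> chart_dom M b)) (chart M b \<circ> chart_inv M a)"
  using assms unfolding smooth_manifold_def by blast+

lemma chart_inv_chart:
  assumes "smooth_manifold M" "p \<in> chart_dom M a"
  shows "chart_inv M a (chart M a p) = p"
  using smooth_manifoldD(4)[OF assms(1)] assms(2) by (rule homeomorphism_apply1)

lemma chart_chart_inv:
  assumes "smooth_manifold M" "u \<in> chart_img M a"
  shows "chart M a (chart_inv M a u) = u" "chart_inv M a u \<in> chart_dom M a"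
  using smooth_manifoldD(4)[OF assms(1)] assms(2)
  by (auto simp: homeomorphism_def)

lemma chart_in_chart_img: "p \<in> chart_dom M a \<Longrightarrow> chart M a p \<in> chart_img M a"
  by (simp add: chart_img_def)

lemma has_derivative_coord_change:
  assumes "smooth_manifold M" "p \<in> chart_dom M a" "p \<in> chart_dom M b"
  shows "((chart M b \<circ> chart_inv M a) has_derivative coord_change M a b p) (at (chart M a p))"
  unfolding coord_change_def
  by (rule smooth_on_has_derivative[OF smooth_manifoldD(5)[OF assms(1)]]) (use assms in auto)

lemma coord_change_self:
  assumes "smooth_manifold M" "p \<in> chart_dom M a"
  shows "coord_change M a a p = id"
proof -
  have "(id has_derivative id) (at (chart M a p))"
    by (simp add: id_def)
  then have "((chart M a \<circ> chart_inv M a) has_derivative id) (at (chart M a p))"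
    by (rule has_derivative_transform_within_open[OF _ smooth_manifoldD(3)[OF assms(1)]])
       (use chart_chart_inv(1)[OF assms(1)] chart_in_chart_img[OF assms(2)] in auto)
  then show ?thesis
    using has_derivative_unique has_derivative_coord_change[OF assms(1) assms(2) assms(2)] by blast
qed

lemma riemannian_manifoldD:
  assumes "riemannian_manifold M"
  shows "smooth_manifold M" "inner_form (riem M p)"
    "smooth_on (chart_img M a)
        (\<lambda>u. let p = chart_inv M a u
             in riem M p (coord_change M a p p v) (coord_change M a p p w))"
  using assms unfolding riemannian_manifold_def inner_form_def by blast+

text \<open>
  Expanding both arguments in the standard basis bounds a quadratic form by the entries of its matrix, which
  depend continuously on the point when the form is a Riemannian metric.
\<close>

lemma bilinear_diagonal_le:
  fixes B :: "'u::euclidean_space \<Rightarrow> 'u \<Rightarrow> real"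
  assumes "bilinear B"
  shows "B v v \<le> (\<Sum>b'\<in>Basis. \<Sum>b\<in>Basis. \<bar>B b b'\<bar>) * (norm v)\<^sup>2"
proof -
  have "B v v \<le> (\<Sum>b'\<in>Basis. \<bar>B v b'\<bar>) * norm v"
    using linear_norm_le_sum_Basis[of "B v" v] assms by (auto simp: bilinear_def)
  also have "\<dots> \<le> (\<Sum>b'\<in>Basis. (\<Sum>b\<in>Basis. \<bar>B b b'\<bar>) * norm v) * norm v"
  proof (intro mult_right_mono sum_mono)
    fix b' :: 'u
    show "\<bar>B v b'\<bar> \<le> (\<Sum>b\<in>Basis. \<bar>B b b'\<bar>) * norm v"
      using linear_norm_le_sum_Basis[of "\<lambda>v. B v b'" v] assms by (simp add: bilinear_def)
  qed simp
  finally show ?thesis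
    by (simp add: power2_eq_square flip: sum_distrib_right)
qed

lemma bilinear_compose_linear:
  assumes "linear D" "bilinear B"
  shows "bilinear (\<lambda>v w. B (D v) (D w))"
  using linear_compose[OF assms(1), of "B (D v)" for v]
    linear_compose[OF assms(1), of "\<lambda>v. B v (D w)" for w] assms(2)
  by (simp add: bilinear_def comp_def)

text \<open>
  Near the centre of a chart the Riemannian norm is bounded by a multiple of the norm of the model space,
  because the coefficients of the metric are continuous in the chart.
\<close>

lemma tnorm_chart_bound:
  fixes M :: "('a::{t2_space, second_countable_topology}, 'e::euclidean_space) manifold"
  assumes "riemannian_manifold M"
  obtains r C where "r > 0" "C \<ge> 0" "ball (chart M y y) r \<subseteq> chart_img M y"
    "\<And>u v p. u \<in> ball (chart M y y) r \<Longrightarrow> p = chart_inv M y u \<Longrightarrow>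
       tnorm M p (coord_change M y p p v) \<le> C * norm v"
proof -
  note sm = riemannian_manifoldD(1)[OF assms]
  define Bf where "Bf u v w = (let p = chart_inv M y u
             in riem M p (coord_change M y p p v) (coord_change M y p p w))" for u v w
  define F where "F u = (\<Sum>b'\<in>Basis. \<Sum>b\<in>Basis. \<bar>Bf u b b'\<bar>)" for u
  have "continuous_on (chart_img M y) F"
    unfolding F_def Bf_def
    by (intro continuous_intros smooth_on_imp_continuous_on riemannian_manifoldD(3) assms)
  then obtain r where r: "r > 0" "ball (chart M y y) r \<subseteq> chart_img M y"
    and F: "\<And>u. u \<in> ball (chart M y y) r \<Longrightarrow> F u < F (chart M y y) + 1"
    using continuous_on_bounded_near[OF smooth_manifoldD(3)[OF sm]
        chart_in_chart_img[OF smooth_manifoldD(1)[OF sm]], of y F] by blast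
  have F0: "F u \<ge> 0" for u unfolding F_def by (intro sum_nonneg) auto
  define C where "C = sqrt (F (chart M y y) + 1)"
  show ?thesis
  proof (rule that[OF r(1) _ r(2)])
    show "C \<ge> 0" using F0[of "chart M y y"] by (simp add: C_def)
    fix u v p assume u: "u \<in> ball (chart M y y) r" and p: "p = chart_inv M y u"
    have "u \<in> chart_img M y" using u r by blast
    then have "p \<in> chart_dom M y" "chart M y p = u"
      using chart_chart_inv[OF sm] p by auto
    then have "linear (coord_change M y p p)"
      using has_derivative_coord_change[OF sm _ smooth_manifoldD(1)[OF sm]] has_derivative_linear
      by blast
    moreover have "bilinear (riem M p)"
      using riemannian_manifoldD(2)[OF assms] by (simp add: inner_form_def)
    ultimately have "bilinear (Bf u)"
      unfolding Bf_def Let_def p[symmetric] by (rule bilinear_compose_linear)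
    then have "Bf u v v \<le> F u * (norm v)\<^sup>2"
      unfolding F_def by (rule bilinear_diagonal_le)
    also have "\<dots> \<le> (F (chart M y y) + 1) * (norm v)\<^sup>2"
      using F[OF u] by (intro mult_right_mono) auto
    finally have "sqrt (Bf u v v) \<le> sqrt ((F (chart M y y) + 1) * (norm v)\<^sup>2)"
      by (rule real_sqrt_le_mono)
    then show "tnorm M p (coord_change M y p p v) \<le> C * norm v"
      by (simp add: tnorm_def C_def Bf_def real_sqrt_mult flip: p)
  qed
qed

text \<open>
  The segment between two points of a convex set in the chart is one smooth curve in the manifold. Its
  Riemannian speed is at most \<open>C\<close> times its constant speed in the chart, which bounds its length and with it
  the distance.
\<close>

lemma rdist_le_chart_segment:
  fixes M :: "('a::{t2_space, second_countable_topology}, 'e::euclidean_space) manifold"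
  assumes sm: "smooth_manifold M"
    and S: "open S" "convex S" "S \<subseteq> chart_img M y"
    and bound: "\<And>u v p. u \<in> S \<Longrightarrow> p = chart_inv M y u \<Longrightarrow>
       tnorm M p (coord_change M y p p v) \<le> C * norm v"
    and u: "u \<in> S" and u': "u' \<in> S"
  shows "rdist M (chart_inv M y u) (chart_inv M y u') \<le> ennreal (C * norm (u' - u))"
proof -
  define A where "A t = u + t *\<^sub>R (u' - u)" for t
  define c where "c t = chart_inv M y (A t)" for t
  define J where "J = A -` S"
  have contA: "continuous_on UNIV A" unfolding A_def by (intro continuous_intros)
  have J01: "{0..1} \<subseteq> J"
  proof
    fix t :: real assume t: "t \<in> {0..1}"
    have "A t = (1 - t) *\<^sub>R u + t *\<^sub>R u'" by (simp add: A_def algebra_simps)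
    then show "t \<in> J" using convexD_alt[OF S(2) u u'] t by (simp add: J_def)
  qed
  have c: "c t \<in> chart_dom M y" "chart M y (c t) = A t" if "t \<in> J" for t
    using chart_chart_inv[OF sm] that S(3) by (auto simp: J_def c_def)
  have smooth: "smooth_into M J c"
    unfolding smooth_into_def
  proof (intro conjI allI)
    show "open J"
      unfolding J_def using S(1) contA by (rule open_vimage)
    fix q
    let ?D = "chart M y ` (chart_dom M y \<inter> chart_dom M q)"
    have D: "smooth_on ?D (chart M q \<circ> chart_inv M y)"
      by (rule smooth_manifoldD(5)[OF sm])
    have eq: "{s \<in> J. c s \<in> chart_dom M q} = A -` (S \<inter> ?D)"
    proof (intro equalityI subsetI)
      fix s assume "s \<in> {s \<in> J. c s \<in> chart_dom M q}"
      then show "s \<in> A -` (S \<inter> ?D)"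
        using c[of s] by (auto simp: J_def intro!: image_eqI[of _ _ "c s"])
    next
      fix s assume "s \<in> A -` (S \<inter> ?D)"
      then show "s \<in> {s \<in> J. c s \<in> chart_dom M q}"
        using chart_inv_chart[OF sm] by (auto simp: J_def c_def)
    qed
    have "open (A -` (S \<inter> ?D))"
      using D S(1) by (intro open_vimage contA) (auto simp: smooth_on_def)
    then have "smooth_on (A -` (S \<inter> ?D)) (\<lambda>t. (chart M q \<circ> chart_inv M y) (u + t *\<^sub>R (u' - u)))"
      by (intro smooth_on_affine[OF bounded_linear_scaleR_left _ _ D]) (auto simp: A_def)
    then show "smooth_on {s \<in> J. c s \<in> chart_dom M q} (chart M q \<circ> c)"
      unfolding eq by (simp add: comp_def c_def A_def)
  qed
  have "piecewise_smooth_curve M c"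
    unfolding piecewise_smooth_curve_def smooth_arc_def
    using smooth J01 by (intro exI[of _ 1] exI[of _ real]) auto
  moreover have "c 0 = chart_inv M y u" "c 1 = chart_inv M y u'"
    by (simp_all add: c_def A_def)
  ultimately have "rdist M (chart_inv M y u) (chart_inv M y u') \<le> curve_length M c"
    unfolding rdist_def by (intro INF_lower) auto
  also have "\<dots> \<le> (\<integral>\<^sup>+t\<in>{0..1::real}. ennreal (C * norm (u' - u)) \<partial>lborel)"
    unfolding curve_length_def
  proof (intro nn_integral_mono)
    fix t :: real
    show "ennreal (tnorm M (c t) (velocity M c t)) * indicator {0..1} t
        \<le> ennreal (C * norm (u' - u)) * indicator {0..1} t"
    proof (cases "t \<in> {0..1}")
      case True
      then have "t \<in> J" using J01 by blast
      have der: "((chart M (c t) \<circ> chart_inv M y) has_derivative coord_change M y (c t) (c t)) (at (A t))"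
        using has_derivative_coord_change[OF sm c(1)[OF \<open>t \<in> J\<close>] smooth_manifoldD(1)[OF sm]]
        by (simp add: c(2)[OF \<open>t \<in> J\<close>])
      have "(A has_derivative (\<lambda>h. h *\<^sub>R (u' - u))) (at t)"
        unfolding A_def by (auto intro!: derivative_eq_intros)
      from has_derivative_compose[OF this der]
      have "((chart M (c t) \<circ> c) has_derivative
          (\<lambda>h. coord_change M y (c t) (c t) (h *\<^sub>R (u' - u)))) (at t)"
        by (simp add: comp_def c_def)
      then have "velocity M c t = coord_change M y (c t) (c t) (u' - u)"
        unfolding velocity_def
        by (intro vector_derivative_at)
           (simp add: has_vector_derivative_def linear_scale[OF has_derivative_linear[OF der]])
      then have "tnorm M (c t) (velocity M c t) \<le> C * norm (u' - u)"
        using bound[of "A t" "c t"] \<open>t \<in> J\<close> by (simp add: J_def c_def)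
      then show ?thesis by (intro mult_right_mono ennreal_leI) auto
    qed simp
  qed
  also have "\<dots> = ennreal (C * norm (u' - u))"
    by (simp add: nn_integral_cmult_indicator)
  finally show ?thesis .
qed

text \<open>
  The Riemannian distance is locally at most a multiple of the distance in the chart, so the Lipschitz
  condition carries over to the chart.
\<close>

lemma locally_lipschitz_in_chart:
  fixes M :: "('a::{t2_space, second_countable_topology}, 'e::euclidean_space) manifold"
  assumes M: "riemannian_manifold M" and f: "locally_lipschitz M f"
  obtains r K where "r > 0" "K-lipschitz_on (ball (chart M y y) r) (f \<circ> chart_inv M y)"
proof -
  note sm = riemannian_manifoldD(1)[OF M]
  let ?z = "chart M y y"
  obtain U L where U: "open U" "y \<in> U" "L > 0"
    and L: "\<And>z y. z \<in> U \<Longrightarrow> y \<in> U \<Longrightarrow> ennreal \<bar>f z - f y\<bar> \<le> ennreal L * rdist M z y"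
    using f unfolding locally_lipschitz_def by metis
  obtain r C where r: "r > 0" "C \<ge> 0" "ball ?z r \<subseteq> chart_img M y"
    and C: "\<And>u v p. u \<in> ball ?z r \<Longrightarrow> p = chart_inv M y u \<Longrightarrow>
       tnorm M p (coord_change M y p p v) \<le> C * norm v"
    using tnorm_chart_bound[OF M, of y] by blast
  have "continuous_on (chart_img M y) (chart_inv M y)"
    using smooth_manifoldD(4)[OF sm] by (simp add: homeomorphism_def)
  then have "open (chart_img M y \<inter> chart_inv M y -` U)"
    using smooth_manifoldD(3)[OF sm] U(1) by (rule continuous_open_preimage)
  moreover have "?z \<in> chart_img M y \<inter> chart_inv M y -` U"
    using chart_inv_chart[OF sm] chart_in_chart_img smooth_manifoldD(1)[OF sm] U(2) by (metis IntI vimageI)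
  ultimately obtain r' where r': "r' > 0" "ball ?z r' \<subseteq> chart_img M y \<inter> chart_inv M y -` U"
    by (meson open_contains_ball)
  have "\<bar>f (chart_inv M y u) - f (chart_inv M y v)\<bar> \<le> (L * C) * norm (u - v)"
    if uv: "u \<in> ball ?z (min r r')" "v \<in> ball ?z (min r r')" for u v
  proof -
    have "ennreal \<bar>f (chart_inv M y u) - f (chart_inv M y v)\<bar>
        \<le> ennreal L * rdist M (chart_inv M y u) (chart_inv M y v)"
      using uv r' by (intro L) auto
    also have "\<dots> \<le> ennreal L * ennreal (C * norm (v - u))"
      using uv by (intro mult_left_mono rdist_le_chart_segment[OF sm open_ball convex_ball r(3) C]) auto
    also have "\<dots> = ennreal ((L * C) * norm (u - v))"
      using U(3) r(2) by (simp add: ennreal_mult' mult.assoc norm_minus_commute)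
    finally show ?thesis
      using U(3) r(2) by (simp add: ennreal_le_iff)
  qed
  then have "(L * C)-lipschitz_on (ball ?z (min r r')) (f \<circ> chart_inv M y)"
    using r(2) U(3) by (intro lipschitz_onI) (auto simp: dist_norm)
  then show ?thesis
    using r(1) r'(1) by (intro that[of "min r r'" "L * C"]) auto
qed

section \<open>Retraction curves in a chart\<close>

lemma retraction_onD:
  assumes "retraction_on M R"
  shows "R x 0 = x" "DR M R x 0 = id" "smooth_retraction_map M R"
  using assms unfolding retraction_on_def by blast+

text \<open>
  Smoothness of the retraction on the tangent bundle is tested in a bundle chart. Restricting it to the
  fibre over the centre of the chart, where the change of components is the identity, amounts to composing
  with an affine map.
\<close>

lemma smooth_on_chart_retraction:
  fixes M :: "('a::{t2_space, second_countable_topology}, 'e::euclidean_space) manifold"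
  assumes sm: "smooth_manifold M" and R: "smooth_retraction_map M R"
  shows "smooth_on {v. R p v \<in> chart_dom M q} (chart M q \<circ> R p)"
proof -
  define H where "H = (\<lambda>(u, v). let p' = chart_inv M p u in R p' (coord_change M p p' p' v))"
  define S where "S = {s \<in> chart_img M p \<times> UNIV. H s \<in> chart_dom M q}"
  have S: "smooth_on S (chart M q \<circ> H)"
    using R unfolding smooth_retraction_map_def smooth_into_def S_def H_def by blast
  have p: "p \<in> chart_dom M p" by (rule smooth_manifoldD(1)[OF sm])
  have H: "H (chart M p p, v) = R p v" for v
    by (simp add: H_def chart_inv_chart[OF sm p] coord_change_self[OF sm p])
  have V: "{v. R p v \<in> chart_dom M q} = (\<lambda>v. (chart M p p, v)) -` S"
    using chart_in_chart_img[OF p] by (auto simp: S_def H)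
  have "open ((\<lambda>v. (chart M p p, v)) -` S)"
    using S by (intro open_vimage continuous_intros) (auto simp: smooth_on_def)
  then have "smooth_on ((\<lambda>v. (chart M p p, v)) -` S) (\<lambda>v. (chart M q \<circ> H) ((chart M p p, 0) + (0, v)))"
    by (intro smooth_on_affine[OF _ _ _ S] bounded_linear_Pair bounded_linear_zero bounded_linear_ident) auto
  then show ?thesis
    unfolding V by (rule smooth_on_cong) (simp add: H)
qed

lemma has_derivative_DR:
  fixes M :: "('a::{t2_space, second_countable_topology}, 'e::euclidean_space) manifold"
  assumes "smooth_manifold M" "smooth_retraction_map M R"
  shows "((chart M (R x \<eta>) \<circ> R x) has_derivative DR M R x \<eta>) (at \<eta>)"
  unfolding DR_def
  by (rule smooth_on_has_derivative[OF smooth_on_chart_retraction[OF assms]])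
     (simp add: smooth_manifoldD(1)[OF assms(1)])

lemma eventually_chart_curve:
  fixes M :: "('a::{t2_space, second_countable_topology}, 'e::euclidean_space) manifold"
  assumes sm: "smooth_manifold M" and R: "smooth_retraction_map M R"
  assumes y: "R x \<eta> = y" and "r > 0"
  shows "eventually (\<lambda>h. R x (\<eta> + h *\<^sub>R v) \<in> chart_dom M y \<and>
    chart M y (R x (\<eta> + h *\<^sub>R v)) \<in> ball (chart M y y) r) (nhds (0::real))"
proof -
  let ?V = "{v. R x v \<in> chart_dom M y}"
  have V: "smooth_on ?V (chart M y \<circ> R x)" by (rule smooth_on_chart_retraction[OF sm R])
  have "open (?V \<inter> (chart M y \<circ> R x) -` ball (chart M y y) r)"
    using smooth_on_imp_continuous_on[OF V] V
    by (intro continuous_open_preimage) (auto simp: smooth_on_def)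
  then have "eventually (\<lambda>w. w \<in> ?V \<inter> (chart M y \<circ> R x) -` ball (chart M y y) r) (nhds \<eta>)"
    using smooth_manifoldD(1)[OF sm, of y] y \<open>r > 0\<close> by (intro eventually_nhds_in_open) auto
  moreover have "((\<lambda>h. \<eta> + h *\<^sub>R v) \<longlongrightarrow> \<eta> + 0 *\<^sub>R v) (nhds 0)"
    by (intro tendsto_intros filterlim_ident)
  then have "((\<lambda>h. \<eta> + h *\<^sub>R v) \<longlongrightarrow> \<eta>) (nhds 0)" by simp
  ultimately have "eventually (\<lambda>h. \<eta> + h *\<^sub>R v \<in> ?V \<inter> (chart M y \<circ> R x) -` ball (chart M y y) r) (nhds 0)"
    by (rule eventually_compose_filterlim)
  then show ?thesis by (auto elim!: eventually_mono)
qed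

text \<open>
  In the chart at \<open>y\<close> the map \<open>R y\<close> is smooth, hence locally Lipschitz, and so is \<open>f\<close>. The composition is
  Lipschitz on a ball that is small enough to be mapped into the ball on which \<open>f\<close> is Lipschitz.
\<close>

lemma locally_lipschitz_retraction_pullback:
  fixes M :: "('a::{t2_space, second_countable_topology}, 'e::euclidean_space) manifold"
  assumes M: "riemannian_manifold M" and f: "locally_lipschitz M f" and R: "retraction_on M R"
  obtains r K where "r > 0" "K-lipschitz_on (ball 0 r) (f \<circ> R y)"
proof -
  note sm = riemannian_manifoldD(1)[OF M]
  let ?z = "chart M y y"
  let ?V = "{v. R y v \<in> chart_dom M y}"
  let ?k = "chart M y \<circ> R y"
  have k0: "?k 0 = ?z" and "0 \<in> ?V"
    using retraction_onD(1)[OF R] smooth_manifoldD(1)[OF sm] by auto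
  obtain r K where r: "r > 0" and K: "K-lipschitz_on (ball ?z r) (f \<circ> chart_inv M y)"
    using locally_lipschitz_in_chart[OF M f] by blast
  obtain r' K' where r': "r' > 0" "ball 0 r' \<subseteq> ?V" and K': "K'-lipschitz_on (ball 0 r') ?k"
    using smooth_on_locally_lipschitz[OF smooth_on_chart_retraction[OF sm retraction_onD(3)[OF R]]
        \<open>0 \<in> ?V\<close>] by blast
  have "K' \<ge> 0" using K' by (rule lipschitz_on_nonneg)
  define \<delta> where "\<delta> = min r' (r / (K' + 1))"
  have "\<delta> > 0" using r r'(1) \<open>K' \<ge> 0\<close> by (simp add: \<delta>_def)
  have sub: "ball 0 \<delta> \<subseteq> ball 0 r'" by (auto simp: \<delta>_def)
  have "?k ` ball 0 \<delta> \<subseteq> ball ?z r"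
  proof (intro image_subsetI)
    fix u :: 'e assume u: "u \<in> ball 0 \<delta>"
    then have "dist (?k 0) (?k u) \<le> K' * dist 0 u"
      using r'(1) subsetD[OF sub u] by (intro lipschitz_onD[OF K']) auto
    also have "\<dots> \<le> (K' + 1) * norm u" by (simp add: algebra_simps)
    also have "\<dots> < r" using u \<open>K' \<ge> 0\<close> by (simp add: \<delta>_def field_simps)
    finally show "?k u \<in> ball ?z r" unfolding k0 by simp
  qed
  then have "(K * K')-lipschitz_on (ball 0 \<delta>) ((f \<circ> chart_inv M y) \<circ> ?k)"
    by (intro lipschitz_on_compose lipschitz_on_subset[OF K'] lipschitz_on_subset[OF K] sub)
  moreover have "(f \<circ> R y) u = ((f \<circ> chart_inv M y) \<circ> ?k) u" if "u \<in> ball 0 \<delta>" for u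
    using subsetD[OF r'(2) subsetD[OF sub that]] by (simp add: chart_inv_chart[OF sm])
  ultimately have "(K * K')-lipschitz_on (ball 0 \<delta>) (f \<circ> R y)"
    by (rule lipschitz_on_transform)
  with \<open>\<delta> > 0\<close> show ?thesis by (rule that)
qed

text \<open>
  The curve \<open>h \<mapsto> R x (\<eta> + h v)\<close> and the curve \<open>h \<mapsto> R y (h w)\<close> with \<open>w = DR M R x \<eta> v\<close> start at \<open>y\<close> with the
  same velocity \<open>w\<close>, the second one because the differential of \<open>R y\<close> at zero is the identity. In the chart they
  differ by \<open>o(h)\<close>, and so do the values of the locally Lipschitz function \<open>f\<close> along them. Along the second
  curve the Clarke derivative of \<open>f \<circ> R y\<close> at zero controls the growth directly.
\<close>

lemma right_Dini_le_clarke_dd: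
  fixes M :: "('a::{t2_space, second_countable_topology}, 'e::euclidean_space) manifold"
  assumes M: "riemannian_manifold M" and f: "locally_lipschitz M f" and R: "retraction_on M R"
    and y: "R x \<eta> = y" and c: "clarke_dd (f \<circ> R y) 0 (DR M R x \<eta> v) < ereal c"
  shows "eventually (\<lambda>h. f (R x (\<eta> + h *\<^sub>R v)) \<le> f y + c * h) (at_right 0)"
proof -
  note sm = riemannian_manifoldD(1)[OF M] and sR = retraction_onD(3)[OF R]
  define w where "w = DR M R x \<eta> v"
  define k\<^sub>1 where "k\<^sub>1 h = chart M y (R x (\<eta> + h *\<^sub>R v))" for h
  define k\<^sub>2 where "k\<^sub>2 h = chart M y (R y (0 + h *\<^sub>R w))" for h
  obtain c' where c': "clarke_dd (f \<circ> R y) 0 w < ereal c'" "c' < c"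
    using ereal_dense2[OF c] unfolding w_def by auto
  obtain r K where r: "r > 0" and K: "K-lipschitz_on (ball (chart M y y) r) (f \<circ> chart_inv M y)"
    using locally_lipschitz_in_chart[OF M f] by blast
  have K0: "K \<ge> 0" using K by (rule lipschitz_on_nonneg)
  define \<delta> where "\<delta> = (c - c') / (K + 1)"
  have \<delta>: "\<delta> > 0" "K * \<delta> \<le> c - c'"
    using K0 c'(2) by (auto simp: \<delta>_def field_simps)
  have line: "((\<lambda>h::real. a + h *\<^sub>R d) has_derivative (\<lambda>h. h *\<^sub>R d)) (at 0)" for a d :: 'e
    by (auto intro!: derivative_eq_intros)
  have "(k\<^sub>1 has_derivative (\<lambda>h. h *\<^sub>R w)) (at 0)"
  proof -
    have d: "((chart M y \<circ> R x) has_derivative DR M R x \<eta>) (at (\<eta> + 0 *\<^sub>R v))"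
      using has_derivative_DR[OF sm sR, of x \<eta>] y by simp
    from has_derivative_compose[OF line d] show ?thesis
      by (simp add: k\<^sub>1_def[abs_def] w_def linear_scale[OF has_derivative_linear[OF d]])
  qed
  moreover have "(k\<^sub>2 has_derivative (\<lambda>h. h *\<^sub>R w)) (at 0)"
  proof -
    have d: "((chart M y \<circ> R y) has_derivative id) (at (0 + 0 *\<^sub>R w))"
      using has_derivative_DR[OF sm sR, of y 0] retraction_onD(1,2)[OF R] by simp
    from has_derivative_compose[OF line d] show ?thesis
      by (simp add: k\<^sub>2_def[abs_def])
  qed
  ultimately have "((\<lambda>h. k\<^sub>1 h - k\<^sub>2 h) has_derivative (\<lambda>h. 0)) (at 0)"
    by (auto intro!: derivative_eq_intros)
  moreover have "k\<^sub>1 0 = k\<^sub>2 0"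
    using y retraction_onD(1)[OF R] by (simp add: k\<^sub>1_def k\<^sub>2_def)
  ultimately have "((\<lambda>h. norm (k\<^sub>1 h - k\<^sub>2 h) / norm h) \<longlongrightarrow> 0) (at 0)"
    by (simp add: has_derivative_at)
  then have "eventually (\<lambda>h. norm (k\<^sub>1 h - k\<^sub>2 h) / norm h < \<delta>) (at 0)"
    using \<delta>(1) by (rule order_tendstoD)
  then have close: "eventually (\<lambda>h. norm (k\<^sub>1 h - k\<^sub>2 h) / norm h < \<delta>) (at_right 0)"
    by (rule filter_leD[OF at_le, rotated]) simp
  have near: "eventually P (at_right (0::real))" if "eventually P (nhds 0)" for P
    using that by (auto simp: eventually_at_filter elim: eventually_mono)
  have near1: "eventually (\<lambda>h. R x (\<eta> + h *\<^sub>R v) \<in> chart_dom M y \<and> k\<^sub>1 h \<in> ball (chart M y y) r) (at_right 0)"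
    unfolding k\<^sub>1_def by (intro near eventually_chart_curve sm sR y r)
  have near2: "eventually (\<lambda>h. R y (0 + h *\<^sub>R w) \<in> chart_dom M y \<and> k\<^sub>2 h \<in> ball (chart M y y) r) (at_right 0)"
    unfolding k\<^sub>2_def by (intro near eventually_chart_curve sm sR r retraction_onD(1)[OF R])
  have pos: "eventually (\<lambda>h::real. h > 0) (at_right 0)"
    by (rule eventually_at_right_less)
  show ?thesis
    using clarke_dd_right_quotient[OF c'(1)] close near1 near2 pos
  proof eventually_elim
    case (elim h)
    have "\<bar>f (R x (\<eta> + h *\<^sub>R v)) - f (R y (0 + h *\<^sub>R w))\<bar> \<le> K * norm (k\<^sub>1 h - k\<^sub>2 h)"
      using lipschitz_on_normD[OF K, of "k\<^sub>1 h" "k\<^sub>2 h"] elim(3,4)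
      by (simp add: k\<^sub>1_def k\<^sub>2_def chart_inv_chart[OF sm])
    also have "\<dots> \<le> K * (\<delta> * h)"
      using elim(2,5) K0 by (intro mult_left_mono) (auto simp: field_simps)
    also have "\<dots> \<le> (c - c') * h"
      using mult_right_mono[OF \<delta>(2), of h] elim(5) by (simp add: mult.assoc)
    finally show ?case
      using elim(1) retraction_onD(1)[OF R] by (simp add: algebra_simps)
  qed
qed

lemma isCont_locally_lipschitz_retraction_curve:
  fixes M :: "('a::{t2_space, second_countable_topology}, 'e::euclidean_space) manifold"
  assumes M: "riemannian_manifold M" and f: "locally_lipschitz M f" and R: "retraction_on M R"
  shows "isCont (\<lambda>s. f (R x (s *\<^sub>R v))) s"
proof -
  note sm = riemannian_manifoldD(1)[OF M] and sR = retraction_onD(3)[OF R]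
  define y where "y = R x (s *\<^sub>R v)"
  define k where "k h = chart M y (R x (s *\<^sub>R v + h *\<^sub>R v))" for h
  obtain r K where r: "r > 0" and K: "K-lipschitz_on (ball (chart M y y) r) (f \<circ> chart_inv M y)"
    using locally_lipschitz_in_chart[OF M f] by blast
  have "isCont k 0"
  proof -
    have "isCont (chart M y \<circ> R x) (s *\<^sub>R v + 0 *\<^sub>R v)"
      using has_derivative_continuous[OF has_derivative_DR[OF sm sR, of x "s *\<^sub>R v"]] by (simp add: y_def)
    then show ?thesis
      unfolding k_def[abs_def] using isCont_o2[of 0 "\<lambda>h. s *\<^sub>R v + h *\<^sub>R v" "chart M y \<circ> R x"]
      by (simp add: continuous_intros)
  qed
  moreover have "isCont (f \<circ> chart_inv M y) (k 0)"
  proof -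
    have "k 0 \<in> ball (chart M y y) r" using r by (simp add: k_def y_def)
    then show ?thesis
      using lipschitz_on_continuous_on[OF K] continuous_on_eq_continuous_at[OF open_ball] by blast
  qed
  ultimately have "isCont (\<lambda>h. (f \<circ> chart_inv M y) (k h)) 0"
    by (rule isCont_o2)
  moreover have "eventually (\<lambda>h. R x (s *\<^sub>R v + h *\<^sub>R v) \<in> chart_dom M y) (nhds 0)"
    using eventually_chart_curve[OF sm sR y_def[symmetric] r, of v] by (rule eventually_mono) simp
  then have "eventually (\<lambda>h. (f \<circ> chart_inv M y) (k h) = f (R x ((s + h) *\<^sub>R v))) (nhds 0)"
    by (rule eventually_mono) (simp add: k_def chart_inv_chart[OF sm] scaleR_add_left)
  ultimately have "isCont (\<lambda>h. f (R x ((s + h) *\<^sub>R v))) 0"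
    by (rule isCont_cong[THEN iffD1, rotated])
  then show ?thesis
    by (simp add: isCont_iff)
qed

section \<open>Elements of least norm\<close>

text \<open>
  Moving from the element \<open>- g\<close> of least norm towards \<open>e\<close> cannot decrease the norm to first order.
\<close>

lemma min_norm_variational_inequality:
  assumes ip: "inner_form ip" and G: "convex G" "- g \<in> G" "e \<in> G"
    and min: "\<And>z. z \<in> G \<Longrightarrow> ip g g \<le> ip z z"
  shows "ip e g \<le> - ip g g"
proof (rule ccontr)
  assume "\<not> ip e g \<le> - ip g g"
  define d where "d = e + g"
  have bil: "bilinear ip" and sym: "ip v w = ip w v" for v w
    using ip by (auto simp: inner_form_def)
  define a where "a = ip g d"
  have "a > 0"
    using \<open>\<not> ip e g \<le> - ip g g\<close> sym[of e g] by (simp add: a_def d_def bilinear_radd[OF bil])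
  define b where "b = ip d d"
  have "b > 0"
  proof -
    have "d \<noteq> 0" using \<open>a > 0\<close> bilinear_rzero[OF bil] by (auto simp: a_def)
    then show ?thesis using ip by (simp add: inner_form_def b_def)
  qed
  \<comment> \<open>Along the segment the squared norm changes by \<open>- 2 l a + l\<^sup>2 b\<close>, which is negative for this \<open>l\<close>.\<close>
  define l where "l = min 1 (a / b)"
  have l: "0 < l" "l \<le> 1" "l * b \<le> a"
    using \<open>a > 0\<close> \<open>b > 0\<close> by (auto simp: l_def min_def field_simps)
  have "(1 - l) *\<^sub>R (- g) + l *\<^sub>R e \<in> G"
    using convexD_alt[OF G] l by simp
  then have "- g + l *\<^sub>R d \<in> G"
    by (simp add: d_def algebra_simps)
  then have "ip g g \<le> ip (- g + l *\<^sub>R d) (- g + l *\<^sub>R d)" by (rule min)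
  also have "\<dots> = ip g g - 2 * (l * a) + l * (l * b)"
    using sym[of d g]
    by (simp add: bilinear_ladd[OF bil] bilinear_radd[OF bil] bilinear_lsub[OF bil] bilinear_rsub[OF bil]
        bilinear_lneg[OF bil] bilinear_rneg[OF bil]
        bilinear_lmul[OF bil] bilinear_rmul[OF bil] a_def b_def algebra_simps)
  also have "\<dots> \<le> ip g g - 2 * (l * a) + l * a"
    using l by simp
  also have "\<dots> < ip g g" using l \<open>a > 0\<close> by simp
  finally show False by simp
qed

section \<open>Subgradients along a ray, transported back\<close>

context
  fixes M :: "('a::{t2_space, second_countable_topology}, 'e::euclidean_space) manifold"
    and R :: "'a \<Rightarrow> 'e \<Rightarrow> 'a" and T :: "'a \<Rightarrow> 'e \<Rightarrow> 'e \<Rightarrow> 'e"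
  assumes M: "riemannian_manifold M" and R: "retraction_on M R"
    and T: "vector_transport M R T" and iso: "isometric_transport M R T"
    and lock: "locking_condition M R T"
begin

lemma riem_transport: "riem M (R x \<eta>) (T x \<eta> v) (T x \<eta> w) = riem M x v w"
  using iso unfolding isometric_transport_def by blast

lemma linear_transport: "linear (T x \<eta>)"
  using T unfolding vector_transport_def by blast

lemma riem_pos: "v \<noteq> 0 \<Longrightarrow> riem M x v v > 0"
  using riemannian_manifoldD(2)[OF M] by (simp add: inner_form_def)

lemma riem_bilinear: "bilinear (riem M x)"
  using riemannian_manifoldD(2)[OF M] by (simp add: inner_form_def)

lemma transport_nonzero: "v \<noteq> 0 \<Longrightarrow> T x \<eta> v \<noteq> 0"
  using riem_pos[of v x] riem_transport[of x \<eta> v v] bilinear_lzero[OF riem_bilinear] by fastforce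

lemma transport_inv: "T x \<eta> (inv (T x \<eta>) v) = v"
proof -
  have "inj (T x \<eta>)"
    unfolding linear_injective_0[OF linear_transport] using transport_nonzero by blast
  then have "surj (T x \<eta>)" by (rule linear_inj_imp_surj[OF linear_transport])
  then show ?thesis by (rule surj_f_inv_f)
qed

text \<open>
  If the differential annihilated a direction \<open>\<eta> \<noteq> 0\<close>, then by the locking condition so would the transport,
  which is injective because it is isometric. So for \<open>\<eta> \<noteq> 0\<close> the quotient that defines \<open>beta\<close> has a
  nonzero denominator.
\<close>

lemma beta_nonzero: "beta M R x \<eta> \<noteq> 0"
proof (cases "\<eta> = 0")
  case False
  then have "T x \<eta> \<eta> \<noteq> 0" by (rule transport_nonzero)
  then show ?thesis using lock unfolding locking_condition_def by auto
qed (simp add: beta_def)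

text \<open>
  The locking condition speaks of transporting \<open>s g\<close> along itself. By linearity it also gives the transport
  of the direction \<open>g\<close>, and at \<open>s = 0\<close> both sides are \<open>g\<close>.
\<close>

lemma locking_on_ray: "T x (s *\<^sub>R g) g = beta M R x (s *\<^sub>R g) *\<^sub>R DR M R x (s *\<^sub>R g) g"
proof (cases "s = 0")
  case True
  have "T x 0 = id" using T unfolding vector_transport_def by blast
  with True show ?thesis by (simp add: beta_def retraction_onD(2)[OF R])
next
  case False
  have lin: "linear (DR M R x (s *\<^sub>R g))"
    using has_derivative_DR[OF riemannian_manifoldD(1)[OF M] retraction_onD(3)[OF R]]
      has_derivative_linear by blast
  have "s *\<^sub>R T x (s *\<^sub>R g) g = T x (s *\<^sub>R g) (s *\<^sub>R g)"
    by (simp add: linear_scale[OF linear_transport])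
  also have "\<dots> = beta M R x (s *\<^sub>R g) *\<^sub>R DR M R x (s *\<^sub>R g) (s *\<^sub>R g)"
    using lock unfolding locking_condition_def by blast
  also have "\<dots> = s *\<^sub>R beta M R x (s *\<^sub>R g) *\<^sub>R DR M R x (s *\<^sub>R g) g"
    by (simp add: linear_scale[OF lin] mult.commute)
  finally show ?thesis using False by (metis scaleR_left_imp_eq)
qed

text \<open>
  This is what the factor \<open>beta\<close> in the \<open>\<epsilon>\<close>-subdifferential is made for: after an isometric transport back to
  \<open>x\<close>, a subgradient pairs with \<open>g\<close> exactly as it pairs, at its own base point, with the velocity of the curve
  \<open>s \<mapsto> R x (s g)\<close>.
\<close>

lemma riem_pulled_back_subgradient:
  "riem M x (inverse (beta M R x (s *\<^sub>R g)) *\<^sub>R inv (T x (s *\<^sub>R g)) \<xi>) g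
     = riem M (R x (s *\<^sub>R g)) \<xi> (DR M R x (s *\<^sub>R g) g)"
proof -
  let ?\<eta> = "s *\<^sub>R g"
  have "riem M x (inv (T x ?\<eta>) \<xi>) g = riem M (R x ?\<eta>) \<xi> (T x ?\<eta> g)"
    using riem_transport[of x ?\<eta> "inv (T x ?\<eta>) \<xi>" g] by (simp add: transport_inv)
  also have "\<dots> = beta M R x ?\<eta> * riem M (R x ?\<eta>) \<xi> (DR M R x ?\<eta> g)"
    unfolding locking_on_ray by (simp add: bilinear_rmul[OF riem_bilinear])
  finally show ?thesis
    using beta_nonzero by (simp add: bilinear_lmul[OF riem_bilinear])
qed

text \<open>
  A subgradient that attains the Clarke derivative in the direction of the velocity, pulled back to \<open>x\<close>, is
  one of the generators of the \<open>\<epsilon>\<close>-subdifferential, because \<open>s g\<close> lies in the ball of radius \<open>\<epsilon>\<close> and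
  within the injectivity radius.
\<close>

lemma clarke_dd_along_ray_attained:
  assumes f: "locally_lipschitz M f"
    and \<epsilon>: "tnorm M x (s *\<^sub>R g) < \<epsilon>" "ennreal \<epsilon> \<le> inj_radius M R x"
  obtains e where "e \<in> eps_subdiff M R T f \<epsilon> x"
    "clarke_dd (f \<circ> R (R x (s *\<^sub>R g))) 0 (DR M R x (s *\<^sub>R g) g) = ereal (riem M x e g)"
proof -
  define \<eta> where "\<eta> = s *\<^sub>R g"
  define y where "y = R x \<eta>"
  obtain r K where r: "r > 0" and K: "K-lipschitz_on (ball 0 r) (f \<circ> R y)"
    using locally_lipschitz_retraction_pullback[OF M f R] by blast
  obtain \<xi> where \<xi>: "\<xi> \<in> rsubdiff M R f y"
    and dd: "clarke_dd (f \<circ> R y) 0 (DR M R x \<eta> g) = ereal (riem M y \<xi> (DR M R x \<eta> g))"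
    unfolding rsubdiff_def
    by (rule clarke_dd_attained[OF r K riemannian_manifoldD(2)[OF M, of y]])
  let ?e = "inverse (beta M R x \<eta>) *\<^sub>R inv (T x \<eta>) \<xi>"
  have "y \<in> closure (rball M R x \<epsilon>)"
  proof (rule subsetD[OF closure_subset])
    show "y \<in> rball M R x \<epsilon>"
      using \<epsilon>(1) by (simp add: rball_def tball_def y_def \<eta>_def)
  qed
  moreover have "ennreal (tnorm M x \<eta>) < inj_radius M R x"
  proof -
    have "0 \<le> tnorm M x \<eta>"
      using riem_pos[of \<eta> x] bilinear_lzero[OF riem_bilinear] by (cases "\<eta> = 0") (auto simp: tnorm_def)
    then have "ennreal (tnorm M x \<eta>) < ennreal \<epsilon>"
      using \<epsilon>(1) by (intro ennreal_lessI) (auto simp: \<eta>_def)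
    then show ?thesis using \<epsilon>(2) by simp
  qed
  ultimately have "?e \<in> eps_subdiff M R T f \<epsilon> x"
    unfolding eps_subdiff_def using \<xi> y_def[symmetric]
    by - (rule subsetD[OF closure_subset], rule hull_inc, intro CollectI exI conjI, simp_all)
  with dd show ?thesis
    using that[of ?e] riem_pulled_back_subgradient by (simp add: y_def \<eta>_def)
qed

end

section \<open>Descent along the element of least norm\<close>

theorem lemma3p6:
  fixes M :: "('a::{t2_space, second_countable_topology}, 'e::euclidean_space) manifold"
    and R :: "'a \<Rightarrow> 'e \<Rightarrow> 'a"
    and T :: "'a \<Rightarrow> 'e \<Rightarrow> 'e \<Rightarrow> 'e"
    and f :: "nat \<Rightarrow> 'a \<Rightarrow> real"
    and m :: nat
    and x :: 'a
    and \<epsilon> :: real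
    and gbar :: 'e
  assumes "riemannian_manifold M"
    and "complete_manifold M"
    and "retraction_on M R"
    and "global_inj_radius M R > 0"
    and "vector_transport M R T"
    and "isometric_transport M R T"
    and "locking_condition M R T"
    and "\<And>i. i \<in> {1..m} \<Longrightarrow> locally_lipschitz M (f i)"
    and "0 < \<epsilon>" and "ennreal \<epsilon> < inj_radius M R x / 2"
    and "is_arg_min (tnorm M x) (\<lambda>\<xi>. \<xi> \<in> uminus ` G_eps M R T f m \<epsilon> x) gbar"
    and "gbar \<noteq> 0"
  shows "\<forall>t i. 0 \<le> t \<and> t \<le> \<epsilon> / tnorm M x gbar \<and> i \<in> {1..m} \<longrightarrow>
           f i (R x (t *\<^sub>R gbar)) \<le> f i x - t * (tnorm M x gbar)\<^sup>2"
proof (intro allI impI, elim conjE)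
  fix t i assume t: "0 \<le> t" "t \<le> \<epsilon> / tnorm M x gbar" and i: "i \<in> {1..m}"
  note M = assms(1) and R = assms(3) and T = assms(5-7) and f = assms(8)[OF i]
  let ?G = "G_eps M R T f m \<epsilon> x"
  let ?N = "tnorm M x gbar"
  have ip: "inner_form (riem M x)" by (rule riemannian_manifoldD(2)[OF M])
  then have bil: "bilinear (riem M x)" by (simp add: inner_form_def)
  have N: "?N > 0" "?N\<^sup>2 = riem M x gbar gbar"
    using ip \<open>gbar \<noteq> 0\<close> by (auto simp: inner_form_def tnorm_def less_imp_le)
  have \<epsilon>: "ennreal \<epsilon> \<le> inj_radius M R x"
  proof -
    have "inj_radius M R x / 2 \<le> inj_radius M R x"
      by (rule divide_le_posI_ennreal) (simp_all add: mult_2)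
    with assms(10) show ?thesis by simp
  qed
  have "convex ?G" by (simp add: G_eps_def convex_convex_hull)
  moreover have "- gbar \<in> ?G"
    using assms(11) by (auto simp: is_arg_min_def)
  moreover have "riem M x gbar gbar \<le> riem M x z z" if "z \<in> ?G" for z
  proof -
    have "tnorm M x gbar \<le> tnorm M x (- z)"
      using assms(11) that by (fastforce simp: is_arg_min_def)
    then show ?thesis
      by (simp add: tnorm_def bilinear_lneg[OF bil] bilinear_rneg[OF bil])
  qed
  \<comment> \<open>Every subgradient collected in \<open>?G\<close> predicts a descent of at least the squared norm along \<open>gbar\<close>.\<close>
  ultimately have var: "riem M x e gbar \<le> - ?N\<^sup>2" if "e \<in> ?G" for e
    using min_norm_variational_inequality[OF ip] that by (simp add: N(2))
  have "f i (R x (t *\<^sub>R gbar)) \<le> f i (R x (0 *\<^sub>R gbar)) + (- ?N\<^sup>2) * t"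
  proof (rule decrease_of_right_Dini_bound[where \<phi> = "\<lambda>s. f i (R x (s *\<^sub>R gbar))"])
    show "continuous_on {0..t} (\<lambda>s. f i (R x (s *\<^sub>R gbar)))"
      using isCont_locally_lipschitz_retraction_curve[OF M f R]
      by (intro continuous_at_imp_continuous_on) blast
    show "0 \<le> t" by fact
    fix s c :: real assume s: "0 \<le> s" "s < t" and c: "- ?N\<^sup>2 < c"
    have "tnorm M x (s *\<^sub>R gbar) = s * ?N"
      using s by (simp add: tnorm_def bilinear_lmul[OF bil] bilinear_rmul[OF bil] real_sqrt_mult)
    also have "\<dots> < \<epsilon>"
      using less_le_trans[OF s(2) t(2)] N(1) by (simp add: less_divide_eq)
    finally have "tnorm M x (s *\<^sub>R gbar) < \<epsilon>" .
    from clarke_dd_along_ray_attained[OF M R T f this \<epsilon>]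
    obtain e where e: "e \<in> eps_subdiff M R T (f i) \<epsilon> x" and
      dd: "clarke_dd (f i \<circ> R (R x (s *\<^sub>R gbar))) 0 (DR M R x (s *\<^sub>R gbar) gbar)
        = ereal (riem M x e gbar)" by blast
    have "e \<in> ?G"
      unfolding G_eps_def using e i by (intro hull_inc) blast
    with var c have "riem M x e gbar < c" by fastforce
    then show "eventually (\<lambda>h. f i (R x ((s + h) *\<^sub>R gbar)) \<le> f i (R x (s *\<^sub>R gbar)) + c * h) (at_right 0)"
      using right_Dini_le_clarke_dd[OF M f R refl, of x "s *\<^sub>R gbar" gbar c]
      by (simp add: dd scaleR_add_left)
  qed
  then show "f i (R x (t *\<^sub>R gbar)) \<le> f i x - t * ?N\<^sup>2"
    by (simp add: retraction_onD(1)[OF R] mult.commute)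
qed

end
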